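(* Let $\mathbf g=(g_1,\dots,g_s)\subset\mathbb R[\mathbf X]$, $Q=\mathcal Q(\mathbf g)$ and $J=\sqrt[\mathbb R]{\operatorname{supp}Q}$. Define $\widetilde Q=\bigcup_{d\in\mathbb N}\overline{\mathcal Q_d(\mathbf g)}$, where $\overline{\mathcal Q_d(\mathbf g)}$ is the closure of $\mathcal Q_d(\mathbf g)$ in the finite-dimensional space $\mathbb R[\mathbf X]_d$. Then $\widetilde Q=Q+J$ and $\operatorname{supp}\widetilde Q=J$. In particular $\widetilde Q$ is a finitely generated quadratic module and it does not depend on the choice of the generators $\mathbf g$ of $Q$.
   Context: $\mathbb R[\mathbf X]=\mathbb R[X_1,\dots,X_n]$; $\mathbb R[\mathbf X]_t$ is the space of polynomials of degree $\le t$, with its Euclidean topology. $\Sigma^2$ denotes the cone of sums of squares of polynomials and $\Sigma^2_t=\Sigma^2\cap\mathbb R[\mathbf X]_t$. For a finite family $G\subset\mathbb R[\mathbf X]$, the truncated quadratic module is $\mathcal Q_t(G)=\{s_0+\sum_{g\in G}s_g\,g : s_0\in\Sigma^2_t,\ s_g\in\Sigma^2,\ \deg s_g\le t-\deg g\}$ (with $s_g=0$ if $\deg g>t$), and $\mathcal Q(G)=\bigcup_t\mathcal Q_t(G)=\Sigma^2+\sum_{g\in G}\Sigma^2 g$ is the quadratic module generated by $G$. For a quadratic module $Q$, $\operatorname{supp}Q=Q\cap(-Q)$ (an ideal). For an ideal $I$, its real radical is $\sqrt[\mathbb R]{I}=\{f: \exists m\in\mathbb N,\ s\in\Sigma^2,\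 f^{2m}+s\in I\}$. *)

theory Defs
  imports "HOL-Analysis.Analysis" "HOL-Library.Poly_Mapping"
begin

type_synonym 'n rpoly = "('n \<Rightarrow>\<^sub>0 nat) \<Rightarrow>\<^sub>0 real"

definition mdeg :: "('n::finite) rpoly \<Rightarrow> nat" where
  "mdeg p = Max (insert 0 ((\<lambda>a. \<Sum>i\<in>UNIV. Poly_Mapping.lookup a i) ` Poly_Mapping.keys p))"

definition polys_deg :: "nat \<Rightarrow> ('n::finite) rpoly set" where
  "polys_deg t = {p. mdeg p \<le> t}"

definition sos :: "('n::finite) rpoly set" where
  "sos = {f. \<exists>(I::nat set) p. finite I \<and> f = (\<Sum>i\<in>I. (p i)^2)}"

definition qmod_trunc :: "nat \<Rightarrow> ('n::finite) rpoly set \<Rightarrow> 'n rpoly set" where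
  "qmod_trunc t G = {s0 + (\<Sum>g\<in>G. s g * g) | s0 s.
      s0 \<in> sos \<and> mdeg s0 \<le> t \<and>
      (\<forall>g\<in>G. s g \<in> sos \<and> (if mdeg g \<le> t then mdeg (s g) \<le> t - mdeg g else s g = 0))}"

definition qmod :: "('n::finite) rpoly set \<Rightarrow> 'n rpoly set" where
  "qmod G = (\<Union>t. qmod_trunc t G)"

definition supp :: "('n::finite) rpoly set \<Rightarrow> 'n rpoly set" where
  "supp Q = Q \<inter> uminus ` Q"

definition real_radical :: "('n::finite) rpoly set \<Rightarrow> 'n rpoly set" where
  "real_radical I = {f. \<exists>(m::nat) s. s \<in> sos \<and> f ^ (2*m) + s \<in> I}"

text \<open>Closure of a set S in the finite-dimensional space of polynomials of degree
  at most d (Euclidean topology = coefficientwise convergence).\<close>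
definition closure_deg :: "nat \<Rightarrow> ('n::finite) rpoly set \<Rightarrow> 'n rpoly set" where
  "closure_deg d S = {f \<in> polys_deg d. \<exists>x. (\<forall>k. x k \<in> S \<inter> polys_deg d) \<and>
       (\<forall>a. (\<lambda>k. Poly_Mapping.lookup (x k) a) \<longlonglongrightarrow> Poly_Mapping.lookup f a)}"

definition qmod_tilde :: "('n::finite) rpoly set \<Rightarrow> 'n rpoly set" where
  "qmod_tilde G = (\<Union>d. closure_deg d (qmod_trunc d G))"

end

theory Submission
  imports Defs "HOL-Computational_Algebra.Primes"
begin

text \<open>Write \<open>I = supp Q\<close>. Since \<open>f^(2 * m) + s \<in> I\<close> forces \<open>- f^(2 * m) \<in> Q\<close>, \<open>J\<close> is the ordinary
  radical of \<open>I\<close>, and \<open>supp (Q + J) = J\<close> says that if a sum of two elements of \<open>Q\<close> is nilpotent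
  modulo \<open>I\<close>, then so are the summands. This makes the quadratic map
  \<open>(p i) \<mapsto> \<Sum>i. (p i)^2 * g i\<close> modulo \<open>J\<close> definite, so on polynomials of bounded degree its image is
  closed, whence \<open>qmod_tilde G \<subseteq> Q + J\<close>. Conversely, if \<open>- f^(2^k) \<in> Q\<close>, then \<open>f + \<epsilon>\<close> is a sum of
  squares minus a multiple of \<open>f^(2^k)\<close>, in a degree independent of \<open>\<epsilon>\<close>, so \<open>f\<close> lies in the closure
  of a truncation. Finite generation is Hilbert's basis theorem. Monomials are ordered by the
  integers obtained from them by substituting distinct primes for the variables.\<close>

section \<open>Polynomials with prescribed support\<close>

text \<open>A single truncation need not be closed. For \<open>G = {- X^2}\<close> in one variable,
  every \<open>X + \<epsilon>\<close> with \<epsilon> > 0 is a square minus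
  \<open>X^2 / (4 * \<epsilon>)\<close>, so \<open>X\<close> is a limit in fixed degree, yet
  \<open>X\<close> is not in \<open>Q\<close>. The cause is a square vanishing modulo
  \<open>supp Q\<close> whose root does not; radicality of \<open>J\<close> excludes this.
  Compactness also requires representing tuples from one finite-dimensional space: the supports of
  the squares are bounded because leading terms cannot cancel, and their number because rotations
  merge squares. Multipliers that annihilate a generator modulo \<open>J\<close> contribute nothing
  and may be arbitrarily large, so representatives are taken in a complement before normalising.
  Independence of the generators is read off from \<open>Q + J\<close>, as \<open>J\<close> depends
  on \<open>Q\<close> alone.\<close>

abbreviation coef :: "'n rpoly \<Rightarrow> ('n \<Rightarrow>\<^sub>0 nat) \<Rightarrow> real" where
  "coef \<equiv> Poly_Mapping.lookup"

abbreviation mons :: "'n rpoly \<Rightarrow> ('n \<Rightarrow>\<^sub>0 nat) set" where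
  "mons \<equiv> Poly_Mapping.keys"

abbreviation cst :: "real \<Rightarrow> 'n rpoly" where
  "cst \<equiv> Poly_Mapping.single 0"

lemma coef_cst_mult: "coef (cst c * p) a = c * coef p a"
proof -
  have "cst c * p = Poly_Mapping.map ((*) c) p"
    by (simp add: mult_map_scale_conv_mult)
  then show ?thesis by (simp add: map.rep_eq when_def)
qed

lemma cst_mult: "cst a * cst b = cst (a * b)"
  by (simp add: mult_single)

lemma cst_power: "cst a ^ n = cst (a ^ n)"
  by (induction n) (simp_all add: cst_mult)

lemma mons_subset_iff: "mons p \<subseteq> M \<longleftrightarrow> (\<forall>a. a \<notin> M \<longrightarrow> coef p a = 0)"
  by (auto simp: in_keys_iff)

lemma rpoly_eq_sum_single:
  assumes "finite M" "mons p \<subseteq> M"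
  shows "p = (\<Sum>a\<in>M. Poly_Mapping.single a (coef p a))"
proof (rule poly_mapping_eqI)
  fix b
  have "(\<Sum>a\<in>M. coef (Poly_Mapping.single a (coef p a)) b) = (\<Sum>a\<in>M. if a = b then coef p a else 0)"
    by (intro sum.cong) (auto simp: lookup_single)
  also have "\<dots> = coef p b"
    using assms by (auto simp: in_keys_iff subset_iff)
  finally show "coef p b = coef (\<Sum>a\<in>M. Poly_Mapping.single a (coef p a)) b"
    by (simp add: lookup_sum)
qed

lemma coef_mult_sum:
  assumes "finite M" "mons p \<subseteq> M" "finite N" "mons q \<subseteq> N"
  shows "coef (p * q) c = (\<Sum>a\<in>M. \<Sum>b\<in>N. if a + b = c then coef p a * coef q b else 0)"
proof -
  have "p * q = (\<Sum>a\<in>M. Poly_Mapping.single a (coef p a)) * (\<Sum>b\<in>N. Poly_Mapping.single b (coef q b))"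
    using rpoly_eq_sum_single assms by metis
  also have "\<dots> = (\<Sum>a\<in>M. \<Sum>b\<in>N. Poly_Mapping.single (a + b) (coef p a * coef q b))"
    by (simp add: sum_product mult_single)
  finally show ?thesis
    by (simp add: lookup_sum lookup_single) (intro sum.cong; auto simp: when_def)
qed

section \<open>A monomial order\<close>

text \<open>Exponents are recovered as prime multiplicities, whence injectivity. Pulling back the
  order of the naturals gives a total monomial order compatible with addition in which only finitely
  many monomials lie below a given one. That finiteness turns a bound on leading monomials into a
  finite support.\<close>

lemma godel_number_exists:
  "\<exists>N :: ('n::finite \<Rightarrow>\<^sub>0 nat) \<Rightarrow> nat. inj N \<and> (\<forall>a. N a > 0) \<and> (\<forall>a b. N (a + b) = N a * N b)"
proof -
  obtain S where S: "S \<subseteq> {p::nat. prime p}" "finite S" "card S = card (UNIV :: 'n set)"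
    using infinite_arbitrarily_large[OF primes_infinite] by metis
  then obtain P :: "'n \<Rightarrow> nat" where P: "bij_betw P UNIV S"
    by (metis finite finite_same_card_bij)
  have pr: "prime (P i)" for i
    using P S by (auto simp: bij_betw_def)
  have injP: "inj P" using P by (simp add: bij_betw_def)
  define N where "N = (\<lambda>a :: 'n \<Rightarrow>\<^sub>0 nat. \<Prod>i\<in>UNIV. P i ^ Poly_Mapping.lookup a i)"
  have mult: "multiplicity (P i) (N a) = Poly_Mapping.lookup a i" for a i
  proof -
    have "N a = (\<Prod>p\<in>range P. p ^ Poly_Mapping.lookup a (inv P p))"
      unfolding N_def using injP by (simp add: prod.reindex)
    also have "multiplicity (P i) \<dots> = Poly_Mapping.lookup a (inv P (P i))"
      using pr by (subst multiplicity_prod_prime_powers) auto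
    finally show ?thesis using injP by simp
  qed
  have "inj N"
    by (rule injI, rule poly_mapping_eqI) (metis mult)
  moreover have "N a > 0" for a
    unfolding N_def using pr by (auto intro!: prod_pos simp: prime_gt_0_nat)
  moreover have "N (a + b) = N a * N b" for a b
    unfolding N_def by (simp add: lookup_add power_add prod.distrib)
  ultimately show ?thesis by blast
qed

definition godel :: "('n::finite \<Rightarrow>\<^sub>0 nat) \<Rightarrow> nat" where
  "godel = (SOME N. inj N \<and> (\<forall>a. N a > 0) \<and> (\<forall>a b. N (a + b) = N a * N b))"

lemma godel_inj: "inj godel"
  and godel_pos: "godel a > 0"
  and godel_add: "godel (a + b) = godel a * godel b"
  using someI_ex[OF godel_number_exists, folded godel_def] by auto

lemma finite_godel_le: "finite {a. godel a \<le> m}"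
  using finite_vimageI[OF finite_atMost godel_inj, of m] by (simp add: vimage_def)

text \<open>A strict drop in one factor cannot be compensated by the other, since values of
  \<open>godel\<close> multiply and are positive. Hence the product of the top monomials arises in
  only one way.\<close>

lemma godel_add_eq_iff:
  assumes "godel b \<le> godel a" "godel c \<le> godel a'"
  shows "b + c = a + a' \<longleftrightarrow> b = a \<and> c = a'"
proof
  assume "b + c = a + a'"
  then have *: "godel b * godel c = godel a * godel a'"
    by (metis godel_add)
  have "godel b = godel a"
  proof (rule ccontr)
    assume "godel b \<noteq> godel a"
    then have "godel b * godel c < godel a * godel c"
      using assms godel_pos by (simp add: le_neq_implies_less)
    also have "\<dots> \<le> godel a * godel a'" using assms by simp
    finally show False using * by simp
  qed
  then have "b = a" by (rule injD[OF godel_inj])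
  then show "b = a \<and> c = a'" using \<open>b + c = a + a'\<close> by simp
qed auto

text \<open>\<open>a\<close> and \<open>a'\<close> are only upper bounds and may have coefficient
  zero. This allows one common bound to be used for all summands of a sum of squares.\<close>

lemma coef_mult_top:
  assumes "\<And>b. b \<in> mons p \<Longrightarrow> godel b \<le> godel a" "\<And>c. c \<in> mons q \<Longrightarrow> godel c \<le> godel a'"
  shows "coef (p * q) (a + a') = coef p a * coef q a'"
proof -
  define M where "M = insert a (mons p)"
  define N where "N = insert a' (mons q)"
  have "coef (p * q) (a + a')
      = (\<Sum>b\<in>M. \<Sum>c\<in>N. if b + c = a + a' then coef p b * coef q c else 0)"
    unfolding M_def N_def by (rule coef_mult_sum) auto
  also have "\<dots> = (\<Sum>b\<in>M. \<Sum>c\<in>N. if a = b \<and> a' = c then coef p b * coef q c else 0)"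
  proof (intro sum.cong refl)
    fix b c assume "b \<in> M" "c \<in> N"
    then have "godel b \<le> godel a" "godel c \<le> godel a'"
      using assms by (auto simp: M_def N_def)
    then show "(if b + c = a + a' then coef p b * coef q c else 0)
        = (if a = b \<and> a' = c then coef p b * coef q c else 0)"
      by (auto simp: godel_add_eq_iff)
  qed
  also have "\<dots> = (\<Sum>b\<in>M. if a = b then coef p b * coef q a' else 0)"
    by (intro sum.cong refl) (auto simp: N_def)
  also have "\<dots> = coef p a * coef q a'"
    by (simp add: M_def)
  finally show ?thesis .
qed

section \<open>Sums of squares\<close>

text \<open>Leading terms of squares do not cancel.\<close>

lemma sos_summands_support:
  assumes "finite K"
  obtains M :: "('n::finite \<Rightarrow>\<^sub>0 nat) set" where "finite M"
    "\<And>(I :: 'i set) p. finite I \<Longrightarrow> mons (\<Sum>i\<in>I. (p i)^2) \<subseteq> K \<Longrightarrow> (\<forall>i\<in>I. mons (p i) \<subseteq> M)"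
proof
  define m where "m = Max (insert 0 (godel ` K))"
  show "finite {a :: 'n \<Rightarrow>\<^sub>0 nat. godel a \<le> m}" by (rule finite_godel_le)
  fix I :: "'i set" and p :: "'i \<Rightarrow> 'n rpoly"
  assume I: "finite I" and sub: "mons (\<Sum>i\<in>I. (p i)^2) \<subseteq> K"
  define U where "U = (\<Union>i\<in>I. mons (p i))"
  have finU: "finite U" using I by (simp add: U_def)
  show "\<forall>i\<in>I. mons (p i) \<subseteq> {a. godel a \<le> m}"
  proof (cases "U = {}")
    case True
    then show ?thesis by (auto simp: U_def)
  next
    case False
    have "Max (godel ` U) \<in> godel ` U"
      using finU False by simp
    then obtain a where a: "a \<in> U" "godel a = Max (godel ` U)" by auto
    then have top: "godel b \<le> godel a" if "b \<in> U" for b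
      using finU that by simp
    have "coef (\<Sum>i\<in>I. (p i)^2) (a + a) = (\<Sum>i\<in>I. (coef (p i) a)^2)"
      unfolding lookup_sum power2_eq_square
      by (intro sum.cong refl coef_mult_top) (auto intro!: top simp: U_def)
    also have "\<dots> \<noteq> 0"
      using I a(1) by (subst sum_nonneg_eq_0_iff) (auto simp: U_def in_keys_iff)
    finally have "a + a \<in> K" using sub by (auto simp: in_keys_iff)
    then have "godel (a + a) \<le> m" using assms by (simp add: m_def)
    \<comment> \<open>Only \<open>a + a\<close> is known to lie in \<open>K\<close>; the bound
      passes to \<open>a\<close> because every value of \<open>godel\<close> is at least 1.\<close>
    moreover have "godel a \<le> godel (a + a)" using godel_pos[of a] by (simp add: godel_add)
    ultimately have "godel b \<le> m" if "b \<in> U" for b using top[OF that] by simp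
    then show ?thesis by (auto simp: U_def)
  qed
qed

text \<open>A rotation in the plane spanned by two summands eliminates a prescribed monomial from one of
  them.\<close>

lemma sum_squares_eliminate:
  fixes p :: "'i \<Rightarrow> 'n rpoly"
  assumes "finite I" "\<And>i. i \<in> I \<Longrightarrow> mons (p i) \<subseteq> M"
  shows "\<exists>r q. (\<Sum>i\<in>I. (p i)^2) = r^2 + (\<Sum>i\<in>I. (q i)^2) \<and> mons r \<subseteq> M \<and> (\<forall>i\<in>I. mons (q i) \<subseteq> M - {a})"
  using assms
proof (induction I rule: finite_induct)
  case empty
  then show ?case by (intro exI[of _ 0]) auto
next
  case (insert i I)
  then obtain r q where rq: "(\<Sum>i\<in>I. (p i)^2) = r^2 + (\<Sum>i\<in>I. (q i)^2)"
      "mons r \<subseteq> M" "\<forall>i\<in>I. mons (q i) \<subseteq> M - {a}" by auto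
  have pM: "mons (p i) \<subseteq> M" using insert by auto
  have "\<exists>r' p'. r^2 + (p i)^2 = r'^2 + p'^2 \<and> mons r' \<subseteq> M \<and> mons p' \<subseteq> M - {a}"
  proof (cases "coef (p i) a = 0")
    case True
    then show ?thesis using pM rq by (intro exI[of _ r] exI[of _ "p i"]) (auto simp: in_keys_iff)
  next
    case False
    \<comment> \<open>\<open>c\<close> and \<open>s\<close> are the cosine and sine of the rotation
      that turns the vector of the two coefficients at \<open>a\<close> onto the first axis; \<rho>
      is its length. Afterwards \<open>r'\<close> carries the coefficient \<rho> and
      \<open>p'\<close> none.\<close>
    define \<rho> where "\<rho> = sqrt ((coef r a)^2 + (coef (p i) a)^2)"
    define c where "c = coef r a / \<rho>"
    define s where "s = coef (p i) a / \<rho>"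
    have \<rho>2: "\<rho>^2 = (coef r a)^2 + (coef (p i) a)^2"
      by (simp add: \<rho>_def)
    have "\<rho>^2 > 0" using False by (simp add: \<rho>2 sum_power2_gt_zero_iff)
    then have cs: "c * c + s * s = 1"
      by (simp add: c_def s_def \<rho>2[symmetric] power2_eq_square[symmetric] power_divide
          add_divide_distrib[symmetric])
    define r' where "r' = cst c * r + cst s * p i"
    define p' where "p' = cst c * p i - cst s * r"
    have "r'^2 + p'^2 = (cst c * cst c + cst s * cst s) * (r^2 + (p i)^2)"
      by (simp add: r'_def p'_def power2_eq_square algebra_simps)
    also have "cst c * cst c + cst s * cst s = (1 :: 'n rpoly)"
      using cs by (simp add: cst_mult single_add[symmetric])
    finally have "r^2 + (p i)^2 = r'^2 + p'^2" by simp
    moreover have "mons r' \<subseteq> M"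
      unfolding r'_def using rq(2) pM by (auto simp: mons_subset_iff lookup_add coef_cst_mult)
    moreover have "mons p' \<subseteq> M"
      unfolding p'_def using rq(2) pM by (auto simp: mons_subset_iff lookup_minus coef_cst_mult)
    moreover have "coef p' a = 0"
      by (simp add: p'_def lookup_minus coef_cst_mult c_def s_def)
    ultimately show ?thesis by (intro exI[of _ r'] exI[of _ p']) (auto simp: in_keys_iff)
  qed
  then obtain r' p' where r'p': "r^2 + (p i)^2 = r'^2 + p'^2" "mons r' \<subseteq> M" "mons p' \<subseteq> M - {a}"
    by blast
  have "(\<Sum>j\<in>I. ((q(i := p')) j)^2) = (\<Sum>j\<in>I. (q j)^2)"
    using insert by (intro sum.cong) auto
  then have "(\<Sum>j\<in>insert i I. (p j)^2) = r'^2 + (\<Sum>j\<in>insert i I. ((q(i := p')) j)^2)"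
    using insert r'p'(1) rq(1) by (simp add: algebra_simps)
  moreover have "\<forall>j\<in>insert i I. mons ((q(i := p')) j) \<subseteq> M - {a}"
    using rq r'p' by auto
  ultimately show ?case using r'p'(2) by blast
qed

text \<open>Each elimination splits off one square and removes one monomial from the support of all
  others, so as many squares as monomials remain, however large \<open>I\<close> was. Indexing them
  by \<open>M\<close> itself gives all sums of squares one common shape.\<close>

lemma sum_squares_few:
  fixes p :: "'i \<Rightarrow> 'n rpoly"
  assumes "finite M" "finite I" "\<And>i. i \<in> I \<Longrightarrow> mons (p i) \<subseteq> M"
  shows "\<exists>q. (\<Sum>i\<in>I. (p i)^2) = (\<Sum>a\<in>M. (q a)^2) \<and> (\<forall>a\<in>M. mons (q a) \<subseteq> M)"
  using assms(1,3)
proof (induction M arbitrary: p rule: finite_induct)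
  case empty
  then have "p i = 0" if "i \<in> I" for i using that by simp
  then show ?case by simp
next
  case (insert a M)
  obtain r p' where r: "(\<Sum>i\<in>I. (p i)^2) = r^2 + (\<Sum>i\<in>I. (p' i)^2)" "mons r \<subseteq> insert a M"
      "\<forall>i\<in>I. mons (p' i) \<subseteq> insert a M - {a}"
    using sum_squares_eliminate[OF assms(2), of p "insert a M" a] insert.prems by metis
  then obtain q where q: "(\<Sum>i\<in>I. (p' i)^2) = (\<Sum>a\<in>M. (q a)^2)" "\<forall>a\<in>M. mons (q a) \<subseteq> M"
    using insert.IH[of p'] insert.hyps by auto
  have "(\<Sum>b\<in>M. ((q(a := r)) b)^2) = (\<Sum>b\<in>M. (q b)^2)"
    using insert.hyps by (intro sum.cong) auto
  then have "(\<Sum>i\<in>I. (p i)^2) = (\<Sum>b\<in>insert a M. ((q(a := r)) b)^2)"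
    using r(1) q(1) insert.hyps by simp
  moreover have "\<forall>b\<in>insert a M. mons ((q(a := r)) b) \<subseteq> insert a M"
    using q(2) r(2) by auto
  ultimately show ?case by blast
qed

lemma sum_squares_sos:
  assumes "finite A"
  shows "(\<Sum>i\<in>A. (p i)^2) \<in> sos"
proof -
  obtain h where h: "bij_betw h {0..<card A} A"
    using ex_bij_betw_nat_finite[OF assms] by blast
  have "(\<Sum>i\<in>A. (p i)^2) = (\<Sum>j\<in>{0..<card A}. (p (h j))^2)"
    using sum.reindex_bij_betw[OF h, of "\<lambda>i. (p i)^2"] by simp
  then show ?thesis
    unfolding sos_def by (intro CollectI exI[of _ "{0..<card A}"] exI[of _ "\<lambda>j. p (h j)"]) simp
qed

lemma square_sos: "p^2 \<in> sos"
  using sum_squares_sos[of "{()}" "\<lambda>_. p"] by simp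

lemma zero_sos: "0 \<in> sos"
  using square_sos[of 0] by simp

lemma sos_add:
  assumes "s \<in> sos" "t \<in> sos"
  shows "s + t \<in> sos"
proof -
  obtain I J :: "nat set" and p q where "finite I" "s = (\<Sum>i\<in>I. (p i)^2)" "finite J" "t = (\<Sum>j\<in>J. (q j)^2)"
    using assms by (auto simp: sos_def)
  then have "s + t = (\<Sum>k\<in>I <+> J. (case_sum p q k)^2)"
    by (simp add: sum.Plus)
  then show ?thesis using sum_squares_sos \<open>finite I\<close> \<open>finite J\<close> by (metis finite_Plus)
qed

lemma sos_square_mult:
  assumes "s \<in> sos"
  shows "h^2 * s \<in> sos"
proof -
  obtain I :: "nat set" and p where "finite I" "s = (\<Sum>i\<in>I. (p i)^2)"
    using assms by (auto simp: sos_def)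
  then have "h^2 * s = (\<Sum>i\<in>I. (h * p i)^2)"
    by (simp add: sum_distrib_left power_mult_distrib)
  then show ?thesis using sum_squares_sos \<open>finite I\<close> by metis
qed

lemma sos_cst_mult:
  assumes "s \<in> sos" "c \<ge> 0"
  shows "cst c * s \<in> sos"
  using sos_square_mult[OF assms(1), of "cst (sqrt c)"] assms(2) by (simp add: cst_power)

section \<open>Ideals and coefficientwise limits\<close>

definition ring_ideal :: "'a::comm_ring_1 set \<Rightarrow> bool" where
  "ring_ideal I \<longleftrightarrow> 0 \<in> I \<and> (\<forall>x\<in>I. \<forall>y\<in>I. x + y \<in> I) \<and> (\<forall>x\<in>I. \<forall>r. r * x \<in> I)"

lemma
  assumes "ring_ideal I"
  shows ideal_zero: "0 \<in> I"
    and ideal_add: "x \<in> I \<Longrightarrow> y \<in> I \<Longrightarrow> x + y \<in> I"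
    and ideal_mult: "x \<in> I \<Longrightarrow> r * x \<in> I"
    and ideal_mult_right: "x \<in> I \<Longrightarrow> x * r \<in> I"
  using assms unfolding ring_ideal_def by (auto simp: mult.commute)

lemma ideal_uminus:
  assumes "ring_ideal I" "x \<in> I"
  shows "- x \<in> I"
  using ideal_mult[OF assms, of "-1"] by simp

lemma ideal_diff:
  assumes "ring_ideal I" "x \<in> I" "y \<in> I"
  shows "x - y \<in> I"
  using ideal_add[OF assms(1,2) ideal_uminus[OF assms(1,3)]] by simp

lemma ideal_sum:
  assumes "ring_ideal I" "\<And>i. i \<in> A \<Longrightarrow> x i \<in> I"
  shows "sum x A \<in> I"
  using assms(2) by (induction A rule: infinite_finite_induct)
    (auto simp: ideal_zero[OF assms(1)] ideal_add[OF assms(1)])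

lemma ideal_cancel_cst:
  assumes "ring_ideal I" "cst c * x \<in> I" "c \<noteq> 0"
  shows "x \<in> I"
proof -
  have "x = cst (1 / c) * (cst c * x)"
    using assms(3) by (simp add: mult.assoc[symmetric] cst_mult)
  then show ?thesis using ideal_mult[OF assms(1,2)] by metis
qed

text \<open>Greedy choice of a monomial basis modulo \<open>U\<close>: \<open>a\<close> joins
  \<open>B\<close> exactly when no nonzero element of \<open>U\<close> is supported on
  \<open>insert a B\<close>. Otherwise such an element involves \<open>a\<close> and can be used to
  eliminate it. The span of \<open>B\<close> is then a linear complement of \<open>U\<close> inside
  the span of \<open>M\<close>.\<close>

lemma monomial_complement:
  assumes "ring_ideal U" "finite M"
  shows "\<exists>B\<subseteq>M. (\<forall>p. mons p \<subseteq> M \<longrightarrow> (\<exists>w. mons w \<subseteq> B \<and> p - w \<in> U))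
    \<and> (\<forall>w\<in>U. mons w \<subseteq> B \<longrightarrow> w = 0)"
  using assms(2)
proof (induction M rule: finite_induct)
  case empty
  then show ?case using ideal_zero[OF assms(1)] by (intro exI[of _ "{}"]) auto
next
  case (insert a M)
  obtain B where B: "B \<subseteq> M"
    "\<forall>p. mons p \<subseteq> M \<longrightarrow> (\<exists>w. mons w \<subseteq> B \<and> p - w \<in> U)"
    "\<forall>w\<in>U. mons w \<subseteq> B \<longrightarrow> w = 0"
    using insert.IH by (elim exE conjE that)
  show ?case
  proof (cases "\<exists>u\<in>U. mons u \<subseteq> insert a B \<and> u \<noteq> 0")
    case True
    then obtain u where u: "u \<in> U" "mons u \<subseteq> insert a B" "u \<noteq> 0" by blast
    then have ua: "coef u a \<noteq> 0" using B(3) by (auto simp: in_keys_iff subset_iff)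
    have "\<exists>w. mons w \<subseteq> B \<and> p - w \<in> U" if p: "mons p \<subseteq> insert a M" for p
    proof -
      define p' where "p' = p - cst (coef p a / coef u a) * u"
      have "mons p' \<subseteq> M"
        unfolding mons_subset_iff
      proof (intro allI impI)
        fix b assume "b \<notin> M"
        then show "coef p' b = 0"
          using p u(2) B(1) ua
          by (cases "b = a") (auto simp: p'_def mons_subset_iff lookup_minus coef_cst_mult)
      qed
      then obtain w where w: "mons w \<subseteq> B" "p' - w \<in> U" using B(2) by blast
      have "p - w = (p' - w) + cst (coef p a / coef u a) * u" by (simp add: p'_def)
      then have "p - w \<in> U"
        using w(2) u(1) assms(1) ideal_add ideal_mult by metis
      then show ?thesis using w(1) by blast
    qed
    then show ?thesis using B(1,3) by (intro exI[of _ B] conjI) auto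
  next
    case False
    have "\<exists>w. mons w \<subseteq> insert a B \<and> p - w \<in> U" if p: "mons p \<subseteq> insert a M" for p
    proof -
      define s where "s = Poly_Mapping.single a (coef p a)"
      have "mons (p - s) \<subseteq> M"
        using p by (auto simp: s_def mons_subset_iff lookup_minus lookup_single when_def)
      then obtain w where w: "mons w \<subseteq> B" "p - s - w \<in> U" using B(2) by blast
      then show ?thesis
        by (intro exI[of _ "s + w"])
          (auto simp: s_def mons_subset_iff lookup_add lookup_single when_def algebra_simps)
    qed
    moreover have "\<forall>w\<in>U. mons w \<subseteq> insert a B \<longrightarrow> w = 0" using False by blast
    ultimately show ?thesis using B(1) by (intro exI[of _ "insert a B"] conjI) auto
  qed
qed

definition mon_sums :: "('n \<Rightarrow>\<^sub>0 nat) set \<Rightarrow> ('n \<Rightarrow>\<^sub>0 nat) set \<Rightarrow> ('n \<Rightarrow>\<^sub>0 nat) set" where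
  "mon_sums M N = (\<lambda>(a, b). a + b) ` (M \<times> N)"

lemma finite_mon_sums: "finite M \<Longrightarrow> finite N \<Longrightarrow> finite (mon_sums M N)"
  by (simp add: mon_sums_def)

lemma mons_mult_subset:
  assumes "mons p \<subseteq> M" "mons q \<subseteq> N"
  shows "mons (p * q) \<subseteq> mon_sums M N"
  using keys_mult[of p q] assms by (force simp: mon_sums_def)

definition coef_lim :: "(nat \<Rightarrow> 'n rpoly) \<Rightarrow> 'n rpoly \<Rightarrow> bool" where
  "coef_lim x f \<longleftrightarrow> (\<forall>a. (\<lambda>k. coef (x k) a) \<longlonglongrightarrow> coef f a)"

lemma coef_lim_const: "coef_lim (\<lambda>k. f) f"
  by (simp add: coef_lim_def)

lemma coef_lim_diff:
  assumes "coef_lim x f" "coef_lim y g"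
  shows "coef_lim (\<lambda>k. x k - y k) (f - g)"
  using assms by (auto simp: coef_lim_def lookup_minus intro!: tendsto_diff)

lemma coef_lim_sum:
  assumes "\<And>i. i \<in> A \<Longrightarrow> coef_lim (\<lambda>k. x k i) (f i)"
  shows "coef_lim (\<lambda>k. \<Sum>i\<in>A. x k i) (\<Sum>i\<in>A. f i)"
  using assms by (auto simp: coef_lim_def lookup_sum intro!: tendsto_sum)

lemma coef_lim_cst_mult:
  assumes "coef_lim x f" "c \<longlonglongrightarrow> (l::real)"
  shows "coef_lim (\<lambda>k. cst (c k) * x k) (cst l * f)"
  using assms by (auto simp: coef_lim_def coef_cst_mult intro!: tendsto_mult)

lemma coef_lim_mons:
  assumes "coef_lim x f" "\<And>k. mons (x k) \<subseteq> M"
  shows "mons f \<subseteq> M"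
  unfolding mons_subset_iff
proof (intro allI impI)
  fix a assume "a \<notin> M"
  then have "(\<lambda>k. coef (x k) a) = (\<lambda>k. 0)" using assms(2) by (auto simp: mons_subset_iff)
  then show "coef f a = 0"
    using assms(1) LIMSEQ_unique[OF _ tendsto_const] by (metis coef_lim_def)
qed

lemma coef_lim_mult:
  assumes "coef_lim x f" "\<And>k. mons (x k) \<subseteq> M" "finite M"
    and "coef_lim y g" "\<And>k. mons (y k) \<subseteq> N" "finite N"
  shows "coef_lim (\<lambda>k. x k * y k) (f * g)"
proof -
  have "mons f \<subseteq> M" "mons g \<subseteq> N"
    using assms coef_lim_mons by blast+
  then have *: "coef (f * g) c = (\<Sum>a\<in>M. \<Sum>b\<in>N. if a + b = c then coef f a * coef g b else 0)" for c
    using assms by (intro coef_mult_sum) auto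
  have **: "coef (x k * y k) c
      = (\<Sum>a\<in>M. \<Sum>b\<in>N. if a + b = c then coef (x k) a * coef (y k) b else 0)" for k c
    using assms by (intro coef_mult_sum) auto
  show ?thesis
    unfolding coef_lim_def * **
  proof (intro allI tendsto_sum)
    fix c a b
    show "(\<lambda>k. if a + b = c then coef (x k) a * coef (y k) b else 0)
        \<longlonglongrightarrow> (if a + b = c then coef f a * coef g b else 0)"
      using assms(1,4) by (auto simp: coef_lim_def intro!: tendsto_mult)
  qed
qed

lemma coef_lim_subseq:
  assumes "coef_lim x f" "strict_mono r"
  shows "coef_lim (\<lambda>k. x (r k)) f"
  using assms LIMSEQ_subseq_LIMSEQ unfolding coef_lim_def by (fastforce simp: o_def)

text \<open>A linear subspace of a finite-dimensional space is closed, proved by elimination. If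
  some element \<open>u\<close> of \<open>I\<close> supported on \<open>insert a M\<close> involves
  \<open>a\<close>, subtracting multiples of \<open>u\<close> is a continuous map preserving
  membership in \<open>I\<close> and removing \<open>a\<close>; otherwise no term of the sequence
  involves \<open>a\<close>.\<close>

lemma ideal_closed:
  assumes I: "ring_ideal I" and "finite M"
    and "\<And>k. x k \<in> I" "\<And>k. mons (x k) \<subseteq> M" "coef_lim x f"
  shows "f \<in> I"
  using assms(2-)
proof (induction M arbitrary: x f rule: finite_induct)
  case empty
  then have "f = 0" using coef_lim_mons[OF empty.prems(3,2)] by simp
  then show ?case using ideal_zero[OF I] by simp
next
  case (insert a M)
  note fM = coef_lim_mons[OF insert.prems(3,2)]
  show ?case
  proof (cases "\<exists>u\<in>I. mons u \<subseteq> insert a M \<and> coef u a \<noteq> 0")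
    case True
    then obtain u where u: "u \<in> I" "mons u \<subseteq> insert a M" "coef u a \<noteq> 0" by blast
    define T where "T = (\<lambda>p. p - cst (coef p a / coef u a) * u)"
    have "T f \<in> I"
    proof (rule insert.IH)
      show "T (x k) \<in> I" for k
        unfolding T_def by (intro ideal_diff ideal_mult I insert.prems u)
      show "mons (T (x k)) \<subseteq> M" for k
        unfolding mons_subset_iff
      proof (intro allI impI)
        fix b assume "b \<notin> M"
        then show "coef (T (x k)) b = 0"
          using insert.prems(2)[of k] u
          by (cases "b = a") (auto simp: T_def mons_subset_iff lookup_minus coef_cst_mult)
      qed
      show "coef_lim (\<lambda>k. T (x k)) (T f)"
        unfolding T_def using insert.prems(3)
        by (intro coef_lim_diff coef_lim_cst_mult coef_lim_const tendsto_divide tendsto_const)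
          (auto simp: coef_lim_def u)
    qed
    then have "T f + cst (coef f a / coef u a) * u \<in> I"
      by (intro ideal_add ideal_mult I u)
    then show ?thesis by (simp add: T_def)
  next
    case False
    then have "mons (x k) \<subseteq> M" for k
      using insert.prems(1,2)[of k] by (auto simp: mons_subset_iff)
    then show ?thesis using insert.IH insert.prems by blast
  qed
qed

section \<open>Closedness of cones generated by squares\<close>

lemma finite_family_convergent_subseq:
  fixes c :: "'i \<Rightarrow> nat \<Rightarrow> real"
  assumes "finite A" "\<And>i. i \<in> A \<Longrightarrow> bounded (range (c i))"
  shows "\<exists>r l. strict_mono r \<and> (\<forall>i\<in>A. (\<lambda>k. c i (r k)) \<longlonglongrightarrow> l i)"
  using assms
proof (induction A rule: finite_induct)
  case empty
  then show ?case by (intro exI[of _ id]) (auto simp: strict_mono_def)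
next
  case (insert i A)
  then obtain r l where r: "strict_mono (r :: nat \<Rightarrow> nat)" "\<forall>j\<in>A. (\<lambda>k. c j (r k)) \<longlonglongrightarrow> l j" by auto
  have "bounded (range (\<lambda>k. c i (r k)))"
    by (rule bounded_subset[OF insert.prems[of i]]) auto
  then obtain m r' where r': "strict_mono r'" "((\<lambda>k. c i (r k)) \<circ> r') \<longlonglongrightarrow> m"
    using bounded_imp_convergent_subsequence by blast
  show ?case
  proof (intro exI[of _ "r \<circ> r'"] exI[of _ "l(i := m)"] conjI ballI)
    show "strict_mono (r \<circ> r')" using r r' by (simp add: strict_mono_o)
    fix j assume "j \<in> insert i A"
    then show "(\<lambda>k. c j ((r \<circ> r') k)) \<longlonglongrightarrow> (l(i := m)) j"
    proof (cases "j = i")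
      case False
      then show ?thesis
        using LIMSEQ_subseq_LIMSEQ[of "\<lambda>k. c j (r k)" "l j" r'] r r' \<open>j \<in> insert i A\<close>
        by (simp add: o_def)
    qed (use r' in \<open>simp add: o_def\<close>)
  qed
qed

text \<open>By \<open>def\<close>, the map sending a tuple \<open>w\<close> to \<open>\<Sum>i\<in>A. (w i)^2 * \<gamma> i\<close> modulo \<open>J\<close> vanishes only at \<open>0\<close>,
  once each \<open>w i\<close> is taken modulo the ideal of all \<open>u\<close> with \<open>u * \<gamma> i \<in> J\<close>; being homogeneous on a
  finite-dimensional space, it has closed image. Rescaling by \<open>\<rho> k\<close> treats bounded and unbounded
  sequences of representing tuples simultaneously.\<close>

lemma definite_cone_closed:
  fixes \<gamma> :: "'i \<Rightarrow> ('n::finite) rpoly"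
  assumes J: "ring_ideal J" and A: "finite A" and M: "finite M"
    and def: "\<And>w. (\<Sum>i\<in>A. (w i)^2 * \<gamma> i) \<in> J \<Longrightarrow> \<forall>i\<in>A. w i * \<gamma> i \<in> J"
    and p: "\<And>k i. i \<in> A \<Longrightarrow> mons (p k i) \<subseteq> M"
    and x: "\<And>k. x k = (\<Sum>i\<in>A. (p k i)^2 * \<gamma> i)"
    and D: "finite D" "\<And>k. mons (x k) \<subseteq> D"
    and lim: "coef_lim x f"
  shows "\<exists>w. f - (\<Sum>i\<in>A. (w i)^2 * \<gamma> i) \<in> J"
proof -
  define U where "U = (\<lambda>i. {u. u * \<gamma> i \<in> J})"
  have U: "ring_ideal (U i)" for i
    unfolding ring_ideal_def U_def using J
    by (auto simp: ideal_zero ideal_add ideal_mult distrib_right mult.assoc)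
  \<comment> \<open>Components in \<open>U i\<close> do not affect the sum modulo \<open>J\<close>
    but could be unbounded; each \<open>p k i\<close> is therefore replaced by its representative
    \<open>w k i\<close> in a complement of \<open>U i\<close>.\<close>
  obtain B where B: "\<And>i. B i \<subseteq> M"
    "\<And>i p. mons p \<subseteq> M \<Longrightarrow> \<exists>w. mons w \<subseteq> B i \<and> p - w \<in> U i"
    "\<And>i w. w \<in> U i \<Longrightarrow> mons w \<subseteq> B i \<Longrightarrow> w = 0"
    using monomial_complement[OF U M] by metis
  have "\<forall>k i. \<exists>w. i \<in> A \<longrightarrow> mons w \<subseteq> B i \<and> p k i - w \<in> U i"
    using B(2) p by meson
  then obtain w where w: "\<And>k i. i \<in> A \<Longrightarrow> mons (w k i) \<subseteq> B i"
      "\<And>k i. i \<in> A \<Longrightarrow> p k i - w k i \<in> U i" by metis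
  \<comment> \<open>The summand 1 keeps \<open>t k\<close> away from zero. After division by
    \<open>t k\<close>, the scale \<rho> and the coefficients of the tuple together have absolute
    sum exactly 1, a condition that survives in the limit.\<close>
  define t where "t = (\<lambda>k. 1 + (\<Sum>i\<in>A. \<Sum>a\<in>M. \<bar>coef (w k i) a\<bar>))"
  define \<rho> where "\<rho> = (\<lambda>k. 1 / t k)"
  define u where "u = (\<lambda>k i. cst (\<rho> k) * w k i)"
  have t: "t k \<ge> 1" for k
    by (auto simp: t_def intro!: sum_nonneg)
  have \<rho>: "0 < \<rho> k" "\<rho> k \<le> 1" for k
    using t[of k] by (auto simp: \<rho>_def)
  have uB: "mons (u k i) \<subseteq> B i" if "i \<in> A" for k i
    using w(1)[OF that, of k] by (auto simp: u_def mons_subset_iff coef_cst_mult)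
  have total: "\<rho> k + (\<Sum>i\<in>A. \<Sum>a\<in>M. \<bar>coef (u k i) a\<bar>) = 1" for k
  proof -
    have "(\<Sum>i\<in>A. \<Sum>a\<in>M. \<bar>coef (u k i) a\<bar>) = \<rho> k * (t k - 1)"
      using \<rho>(1)[of k] by (simp add: u_def coef_cst_mult abs_mult sum_distrib_left t_def)
    then show ?thesis using t[of k] by (simp add: \<rho>_def field_simps)
  qed
  have bound: "\<bar>coef (u k i) a\<bar> \<le> 1" if "i \<in> A" "a \<in> M" for k i a
  proof -
    have "\<bar>coef (u k i) a\<bar> \<le> (\<Sum>a\<in>M. \<bar>coef (u k i) a\<bar>)"
      using M that by (intro member_le_sum) auto
    also have "\<dots> \<le> (\<Sum>i\<in>A. \<Sum>a\<in>M. \<bar>coef (u k i) a\<bar>)"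
      using A that by (intro member_le_sum) (auto intro!: sum_nonneg)
    also have "\<dots> \<le> 1" using total[of k] \<rho>(1)[of k] by simp
    finally show ?thesis .
  qed
  \<comment> \<open>The scale (index \<open>None\<close>) and all coefficients form one finite
    family, so a single subsequence serves for all of them.\<close>
  define c where "c = (\<lambda>e k. case e of None \<Rightarrow> \<rho> k | Some (i, a) \<Rightarrow> coef (u k i) a)"
  have "bounded (range (c e))" if "e \<in> insert None (Some ` (A \<times> M))" for e
    using that \<rho> bound
    by (auto simp: c_def bounded_iff less_imp_le abs_of_pos intro!: exI[of _ 1])
  then obtain r l where r: "strict_mono (r :: nat \<Rightarrow> nat)"
      and l: "\<forall>e\<in>insert None (Some ` (A \<times> M)). (\<lambda>k. c e (r k)) \<longlonglongrightarrow> l e"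
    using finite_family_convergent_subseq[of "insert None (Some ` (A \<times> M))" c] A M by auto
  define v where "v = (\<lambda>i. \<Sum>a\<in>M. Poly_Mapping.single a (l (Some (i, a))))"
  have lim\<rho>: "(\<lambda>k. \<rho> (r k)) \<longlonglongrightarrow> l None"
    using l by (auto simp: c_def)
  have coefv: "coef (v i) a = (if a \<in> M then l (Some (i, a)) else 0)" for i a
  proof -
    have "coef (v i) a = (\<Sum>b\<in>M. if b = a then l (Some (i, b)) else 0)"
      unfolding v_def lookup_sum by (intro sum.cong) (auto simp: lookup_single)
    then show ?thesis using M by simp
  qed
  have limu: "coef_lim (\<lambda>k. u (r k) i) (v i)" if i: "i \<in> A" for i
    unfolding coef_lim_def
  proof
    fix a
    show "(\<lambda>k. coef (u (r k) i) a) \<longlonglongrightarrow> coef (v i) a"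
    proof (cases "a \<in> M")
      case True
      then show ?thesis using l i by (auto simp: c_def coefv)
    next
      case False
      then have "coef (u (r k) i) a = 0" for k using uB[OF i] B(1)[of i] by (auto simp: mons_subset_iff)
      then show ?thesis using False by (simp add: coefv)
    qed
  qed
  have vB: "mons (v i) \<subseteq> B i" if "i \<in> A" for i
    using coef_lim_mons[OF limu[OF that]] uB[OF that] by blast
  have limtotal: "l None + (\<Sum>i\<in>A. \<Sum>a\<in>M. \<bar>coef (v i) a\<bar>) = 1"
  proof (rule LIMSEQ_unique)
    show "(\<lambda>k. \<rho> (r k) + (\<Sum>i\<in>A. \<Sum>a\<in>M. \<bar>coef (u (r k) i) a\<bar>))
        \<longlonglongrightarrow> l None + (\<Sum>i\<in>A. \<Sum>a\<in>M. \<bar>coef (v i) a\<bar>)"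
      using limu by (intro tendsto_add lim\<rho> tendsto_sum tendsto_rabs) (auto simp: coef_lim_def)
  qed (simp add: total)
  define y where "y = (\<lambda>k. cst ((\<rho> k)^2) * x k - (\<Sum>i\<in>A. (u k i)^2 * \<gamma> i))"
  have yJ: "y k \<in> J" for k
  proof -
    \<comment> \<open>Difference of squares: the factor \<open>(p k i - w k i) * \<gamma> i\<close>
      lies in \<open>J\<close> by the definition of \<open>U i\<close>.\<close>
    have "cst ((\<rho> k)^2) * ((p k i)^2 * \<gamma> i) - (u k i)^2 * \<gamma> i
        = cst ((\<rho> k)^2) * ((p k i + w k i) * ((p k i - w k i) * \<gamma> i))" for i
    proof -
      have "(u k i)^2 = cst ((\<rho> k)^2) * (w k i)^2"
        by (simp only: u_def power_mult_distrib cst_power)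
      moreover have "C * ((p k i)^2 * \<gamma> i) - C * (w k i)^2 * \<gamma> i
          = C * ((p k i + w k i) * ((p k i - w k i) * \<gamma> i))" for C
        by (simp add: algebra_simps power2_eq_square)
      ultimately show ?thesis by metis
    qed
    then have "y k = (\<Sum>i\<in>A. cst ((\<rho> k)^2) * ((p k i + w k i) * ((p k i - w k i) * \<gamma> i)))"
      by (simp add: y_def x sum_distrib_left sum_subtractf[symmetric])
    moreover have "(p k i - w k i) * \<gamma> i \<in> J" if "i \<in> A" for i
      using w(2)[OF that, of k] by (simp add: U_def)
    ultimately show ?thesis
      by (metis (no_types, lifting) ideal_sum[OF J] ideal_mult[OF J])
  qed
  have uM: "mons (u k i) \<subseteq> M" if "i \<in> A" for k i
    using uB[OF that] B(1) by (rule subset_trans)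
  then have u2M: "mons ((u k i)^2) \<subseteq> mon_sums M M" if "i \<in> A" for k i
    unfolding power2_eq_square using that by (intro mons_mult_subset)
  define N where "N = D \<union> (\<Union>i\<in>A. mon_sums (mon_sums M M) (mons (\<gamma> i)))"
  have finN: "finite N"
    unfolding N_def using D A M by (simp add: finite_mon_sums)
  have yN: "mons (y k) \<subseteq> N" for k
  proof -
    have *: "mons ((u k i)^2 * \<gamma> i) \<subseteq> N" if "i \<in> A" for i
      using mons_mult_subset[OF u2M[OF that] order_refl] that unfolding N_def by blast
    have "mons (\<Sum>i\<in>A. (u k i)^2 * \<gamma> i) \<subseteq> N"
      by (rule subset_trans[OF keys_sum UN_least[OF *]])
    moreover have "mons (x k) \<subseteq> N" using D(2)[of k] by (auto simp: N_def)
    ultimately show ?thesis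
      by (auto simp: y_def mons_subset_iff lookup_minus coef_cst_mult)
  qed
  have limy: "coef_lim (\<lambda>k. y (r k)) (cst ((l None)^2) * f - (\<Sum>i\<in>A. (v i)^2 * \<gamma> i))"
    unfolding y_def
  proof (intro coef_lim_diff coef_lim_cst_mult coef_lim_subseq[OF lim r] coef_lim_sum tendsto_power lim\<rho>)
    fix i assume i: "i \<in> A"
    have "coef_lim (\<lambda>k. (u (r k) i)^2) ((v i)^2)"
      unfolding power2_eq_square
      by (rule coef_lim_mult[OF limu[OF i] uM[OF i] M limu[OF i] uM[OF i] M])
    then show "coef_lim (\<lambda>k. (u (r k) i)^2 * \<gamma> i) ((v i)^2 * \<gamma> i)"
      by (rule coef_lim_mult[OF _ u2M[OF i] finite_mon_sums[OF M M] coef_lim_const order_refl finite_keys])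
  qed
  have main: "cst ((l None)^2) * f - (\<Sum>i\<in>A. (v i)^2 * \<gamma> i) \<in> J"
    using ideal_closed[OF J finN _ _ limy] yJ yN by blast
  \<comment> \<open>If the scale tended to 0, the limit tuple would represent 0 modulo
    \<open>J\<close>. Definiteness puts each \<open>v i\<close> into \<open>U i\<close>, the
    complement property makes it 0, and the absolute sum 1 is contradicted.\<close>
  have "l None \<noteq> 0"
  proof
    assume l0: "l None = 0"
    then have "(\<Sum>i\<in>A. (v i)^2 * \<gamma> i) \<in> J"
      using ideal_uminus[OF J main] by simp
    then have "v i \<in> U i" if "i \<in> A" for i
      using def that by (auto simp: U_def)
    then have "v i = 0" if "i \<in> A" for i
      using B(3) vB that by blast
    then show False using limtotal l0 by simp
  qed
  define z where "z = (\<lambda>i. cst (1 / l None) * v i)"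
  have "f - (\<Sum>i\<in>A. (z i)^2 * \<gamma> i)
      = cst ((1 / l None)^2) * (cst ((l None)^2) * f - (\<Sum>i\<in>A. (v i)^2 * \<gamma> i))"
  proof -
    have "cst ((1 / l None)^2) * (cst ((l None)^2) * f) = f"
      using \<open>l None \<noteq> 0\<close> by (simp add: mult.assoc[symmetric] cst_mult power_divide)
    moreover have "(\<Sum>i\<in>A. (z i)^2 * \<gamma> i) = cst ((1 / l None)^2) * (\<Sum>i\<in>A. (v i)^2 * \<gamma> i)"
      by (simp add: z_def power_mult_distrib cst_power sum_distrib_left mult.assoc)
    ultimately show ?thesis by (simp add: right_diff_distrib)
  qed
  then have "f - (\<Sum>i\<in>A. (z i)^2 * \<gamma> i) \<in> J"
    using ideal_mult[OF J main] by simp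
  then show ?thesis by blast
qed

section \<open>Quadratic modules and their supports\<close>

definition quad_module :: "'n rpoly set \<Rightarrow> bool" where
  "quad_module M \<longleftrightarrow> 1 \<in> M \<and> (\<forall>x\<in>M. \<forall>y\<in>M. x + y \<in> M) \<and> (\<forall>x\<in>M. \<forall>h. h^2 * x \<in> M)"

lemma
  assumes "quad_module M"
  shows qm_one: "1 \<in> M"
    and qm_add: "x \<in> M \<Longrightarrow> y \<in> M \<Longrightarrow> x + y \<in> M"
    and qm_square_mult: "x \<in> M \<Longrightarrow> h^2 * x \<in> M"
  using assms unfolding quad_module_def by auto

lemma qm_square: "quad_module M \<Longrightarrow> h^2 \<in> M"
  using qm_square_mult[of M 1 h] qm_one[of M] by simp

lemma qm_zero: "quad_module M \<Longrightarrow> 0 \<in> M"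
  using qm_square[of M 0] by simp

lemma qm_sum:
  assumes "quad_module M" "\<And>i. i \<in> A \<Longrightarrow> x i \<in> M"
  shows "sum x A \<in> M"
  using assms(2) by (induction A rule: infinite_finite_induct)
    (auto simp: qm_zero[OF assms(1)] qm_add[OF assms(1)])

lemma qm_sos_mult:
  assumes "quad_module M" "s \<in> sos" "x \<in> M"
  shows "s * x \<in> M"
proof -
  obtain I :: "nat set" and p where "s = (\<Sum>i\<in>I. (p i)^2)"
    using assms(2) by (auto simp: sos_def)
  then show ?thesis
    using assms by (auto simp: sum_distrib_right intro!: qm_sum qm_square_mult)
qed

lemma qm_sos: "quad_module M \<Longrightarrow> s \<in> sos \<Longrightarrow> s \<in> M"
  using qm_sos_mult[of M s 1] qm_one[of M] by simp

lemma supp_iff: "x \<in> supp M \<longleftrightarrow> x \<in> M \<and> - x \<in> M"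
  by (auto simp: supp_def) (metis add.inverse_inverse image_eqI)

text \<open>Polarization: \<open>h\<close> is the difference of the squares of
  \<open>(h + 1) / 2\<close> and \<open>(h - 1) / 2\<close>. A quadratic module containing
  \<open>x\<close> and \<open>- x\<close> therefore contains every multiple of \<open>x\<close>,
  which makes its support an ideal.\<close>

lemma mult_as_square_difference:
  fixes h x :: "'n rpoly"
  shows "h * x = (cst (1/2) * (h + 1))^2 * x + (cst (1/2) * (h - 1))^2 * (- x)"
proof -
  define e :: "'n rpoly" where "e = cst (1/2)"
  have "e + e = 1" by (simp add: e_def single_add[symmetric])
  have "h * x = (e + e) * ((e + e) * (h * x))"
    by (simp only: \<open>e + e = 1\<close> mult_1_left)
  also have "\<dots> = (e * (h + 1))^2 * x + (e * (h - 1))^2 * (- x)"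
    by (simp add: power2_eq_square algebra_simps)
  finally show ?thesis by (simp only: e_def)
qed

lemma supp_ideal:
  assumes M: "quad_module M"
  shows "ring_ideal (supp M)"
  unfolding ring_ideal_def
proof (intro conjI ballI allI)
  show "0 \<in> supp M" using qm_zero[OF M] by (simp add: supp_iff)
  fix x assume x: "x \<in> supp M"
  show "x + y \<in> supp M" if "y \<in> supp M" for y
    using x that qm_add[OF M, of x y] qm_add[OF M, of "-x" "-y"] by (simp add: supp_iff)
  have "r * x \<in> M" if "x \<in> supp M" for r x
    using that by (subst mult_as_square_difference) (intro qm_add[OF M] qm_square_mult[OF M]; simp add: supp_iff)
  from this[of x] this[of "-x"] show "r * x \<in> supp M" for r
    using x by (simp add: supp_iff)
qed

lemma real_radical_supp_iff:
  assumes M: "quad_module M"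
  shows "f \<in> real_radical (supp M) \<longleftrightarrow> (\<exists>n. f ^ n \<in> supp M)"
proof
  assume "f \<in> real_radical (supp M)"
  then obtain m s where ms: "s \<in> sos" "f ^ (2 * m) + s \<in> supp M"
    by (auto simp: real_radical_def)
  have "- (f ^ (2 * m)) = s + - (f ^ (2 * m) + s)" by simp
  then have "- (f ^ (2 * m)) \<in> M"
    using ms qm_sos[OF M] qm_add[OF M] by (metis supp_iff)
  moreover have "f ^ (2 * m) \<in> M"
    using qm_square[OF M, of "f ^ m"] by (simp add: power_mult[symmetric] mult.commute)
  ultimately show "\<exists>n. f ^ n \<in> supp M" by (auto simp: supp_iff)
next
  assume "\<exists>n. f ^ n \<in> supp M"
  then obtain n where "f ^ n \<in> supp M" by blast
  then have "f ^ n * f ^ n \<in> supp M" by (rule ideal_mult[OF supp_ideal[OF M]])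
  then show "f \<in> real_radical (supp M)"
    unfolding real_radical_def
    by (intro CollectI exI[of _ n] exI[of _ 0]) (simp add: zero_sos mult_2 power_add)
qed

lemma radical_ideal:
  assumes I: "ring_ideal (I :: 'a::comm_ring_1 set)"
  shows "ring_ideal {f. \<exists>n::nat. f ^ n \<in> I}"
  unfolding ring_ideal_def
proof (intro conjI ballI allI)
  show "0 \<in> {f. \<exists>n::nat. f ^ n \<in> I}"
    using ideal_zero[OF I] by (auto intro!: exI[of _ 1])
  fix f assume "f \<in> {f. \<exists>n::nat. f ^ n \<in> I}"
  then obtain m where m: "f ^ m \<in> I" by auto
  show "r * f \<in> {f. \<exists>n::nat. f ^ n \<in> I}" for r
    using ideal_mult[OF I m, of "r ^ m"] by (auto simp: power_mult_distrib[symmetric])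
  fix g assume "g \<in> {f. \<exists>n::nat. f ^ n \<in> I}"
  then obtain n where n: "g ^ n \<in> I" by auto
  have "of_nat ((m + n) choose k) * f ^ k * g ^ (m + n - k) \<in> I" if "k \<le> m + n" for k
  proof (cases "m \<le> k")
    case True
    then have "f ^ k = f ^ m * f ^ (k - m)" by (simp flip: power_add)
    then show ?thesis
      using ideal_mult[OF I m] by (metis mult.commute mult.assoc)
  next
    case False
    then have "g ^ (m + n - k) = g ^ (m - k) * g ^ n" by (simp flip: power_add)
    then show ?thesis
      using ideal_mult[OF I n] by (metis mult.assoc)
  qed
  then have "(f + g) ^ (m + n) \<in> I"
    unfolding binomial_ring by (intro ideal_sum[OF I]) auto
  then show "f + g \<in> {f. \<exists>n::nat. f ^ n \<in> I}" by blast
qed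

text \<open>If \<open>q = a + b\<close> then
  \<open>(2 * a)^2 * a + (2 * a + q)^2 * b = q^2 * (3 * a + q)\<close>, so replacing \<open>a\<close> by \<open>(2 * a)^2 * a\<close>
  doubles the order of vanishing of \<open>q\<close>: a Newton step towards the inverse
  square root of \<open>1 - q / a\<close>.\<close>

lemma summand_nilpotent_supp:
  assumes M: "quad_module M" and "a \<in> M" "b \<in> M" "(a + b) ^ n \<in> supp M"
  shows "\<exists>m. a ^ m \<in> supp M"
proof -
  note I = supp_ideal[OF M]
  \<comment> \<open>A Newton step extracts the factor \<open>q^2\<close> from the new sum, so the
    exponent needed is halved; powers of two are the natural induction scale. Since
    \<open>a'\<close> is \<open>4 * a^3\<close>, nilpotency of \<open>a'\<close> returns to
    \<open>a\<close>.\<close>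
  have main: "\<exists>m. a ^ m \<in> supp M" if "a \<in> M" "b \<in> M" "(a + b) ^ (2 ^ k) \<in> supp M" for a b and k :: nat
    using that
  proof (induction k arbitrary: a b)
    case 0
    have "- a = b + - (a + b)" by simp
    then have "- a \<in> M" using 0 qm_add[OF M] by (metis power_0 power_one_right supp_iff)
    then show ?case using 0 by (intro exI[of _ 1]) (simp add: supp_iff)
  next
    case (Suc k)
    define q where "q = a + b"
    define a' where "a' = (2 * a)^2 * a"
    define b' where "b' = (2 * a + q)^2 * b"
    have "a' + b' = q^2 * (3 * a + q)"
      by (simp add: a'_def b'_def q_def power2_eq_square algebra_simps)
    then have "(a' + b') ^ (2 ^ k) = q ^ (2 ^ Suc k) * (3 * a + q) ^ (2 ^ k)"
      by (simp add: power_mult_distrib power_mult)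
    also have "\<dots> \<in> supp M"
      using Suc.prems(3) by (intro ideal_mult_right[OF I]) (simp add: q_def)
    finally have *: "(a' + b') ^ (2 ^ k) \<in> supp M" .
    have "a' \<in> M" "b' \<in> M"
      unfolding a'_def b'_def by (rule qm_square_mult[OF M], fact Suc.prems)+
    then obtain m where m: "a' ^ m \<in> supp M"
      using Suc.IH * by blast
    have "a' = cst 4 * a ^ 3"
      by (simp add: a'_def power2_eq_square power3_eq_cube)
    then have "a' ^ m = cst (4 ^ m) * a ^ (3 * m)"
      by (simp only: power_mult_distrib cst_power power_mult)
    then have "a ^ (3 * m) \<in> supp M"
      using m ideal_cancel_cst[OF I] by simp
    then show ?case by blast
  qed
  have "n \<le> 2 ^ n" by (simp add: less_imp_le)
  then have "(a + b) ^ (2 ^ n) = (a + b) ^ (2 ^ n - n) * (a + b) ^ n" by (simp flip: power_add)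
  then show ?thesis using main[OF assms(2,3)] ideal_mult[OF I assms(4)] by metis
qed

section \<open>Dickson's lemma and the Hilbert basis theorem\<close>

lemma nat_seq_incseq_subseq:
  fixes s :: "nat \<Rightarrow> nat"
  shows "\<exists>r. strict_mono (r :: nat \<Rightarrow> nat) \<and> incseq (s \<circ> r)"
proof -
  obtain r where r: "strict_mono (r :: nat \<Rightarrow> nat)" "monoseq (\<lambda>n. s (r n))"
    using seq_monosub[of s] by blast
  show ?thesis
  proof (cases "incseq (\<lambda>n. s (r n))")
    case True
    then show ?thesis using r by (auto simp: o_def)
  next
    case False
    then have dec: "decseq (\<lambda>n. s (r n))" using r(2) by (simp add: monoseq_iff)
    obtain N where N: "\<And>n. s (r N) \<le> s (r n)"
      using ex_has_least_nat[of "\<lambda>_. True" undefined "\<lambda>n. s (r n)"] by auto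
    then have "s (r (n + N)) = s (r N)" for n
      using decseqD[OF dec, of N "n + N"] by (simp add: order_antisym)
    then have "incseq (s \<circ> (\<lambda>n. r (n + N)))" by (simp add: o_def)
    moreover have "strict_mono (\<lambda>n. r (n + N))" using r(1) by (simp add: strict_mono_def)
    ultimately show ?thesis by blast
  qed
qed

lemma nat_family_incseq_subseq:
  fixes h :: "'i \<Rightarrow> nat \<Rightarrow> nat"
  assumes "finite A"
  shows "\<exists>r. strict_mono (r :: nat \<Rightarrow> nat) \<and> (\<forall>i\<in>A. incseq (h i \<circ> r))"
  using assms
proof (induction A rule: finite_induct)
  case empty
  then show ?case by (intro exI[of _ id]) (auto simp: strict_mono_def)
next
  case (insert i A)
  then obtain r where r: "strict_mono (r :: nat \<Rightarrow> nat)" "\<forall>i\<in>A. incseq (h i \<circ> r)" by blast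
  obtain r' where r': "strict_mono (r' :: nat \<Rightarrow> nat)" "incseq ((h i \<circ> r) \<circ> r')"
    using nat_seq_incseq_subseq by blast
  have "incseq (h j \<circ> (r \<circ> r'))" if "j \<in> insert i A" for j
    using that r r' by (auto simp: incseq_def o_def strict_mono_less_eq)
  moreover have "strict_mono (r \<circ> r')" using r r' by (simp add: strict_mono_o)
  ultimately show ?case by blast
qed

text \<open>\<open>T\<close> consists of the elements of \<open>S\<close> minimal under
  divisibility. Descent on \<open>godel\<close> finds one below each element; an infinite set of
  them would contain a sequence increasing in every exponent along a subsequence, hence two
  comparable minimal elements.\<close>

lemma dickson:
  fixes S :: "('n::finite \<Rightarrow>\<^sub>0 nat) set"
  shows "\<exists>T\<subseteq>S. finite T \<and> (\<forall>a\<in>S. \<exists>b\<in>T. \<exists>c. a = b + c)"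
proof -
  define le where "le = (\<lambda>b a :: 'n \<Rightarrow>\<^sub>0 nat. \<exists>c. a = b + c)"
  have leI: "le b a" if "\<And>i. Poly_Mapping.lookup b i \<le> Poly_Mapping.lookup a i" for a b
    unfolding le_def
    by (intro exI[of _ "a - b"] poly_mapping_eqI) (simp add: lookup_add lookup_minus that)
  have le_trans: "le a c" if "le a b" "le b c" for a b c
    using that by (auto simp: le_def add.assoc)
  have le_godel: "b = a \<or> godel b < godel a" if "le b a" for a b
  proof -
    obtain c where c: "a = b + c" using \<open>le b a\<close> by (auto simp: le_def)
    have "godel b \<le> godel a" using godel_pos[of c] by (simp add: c godel_add)
    then show ?thesis using injD[OF godel_inj, of b a] by linarith
  qed
  define T where "T = {b\<in>S. \<forall>a\<in>S. le a b \<longrightarrow> a = b}"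
  have "\<exists>b\<in>T. le b a" if "a \<in> S" for a
    using that
  proof (induction a rule: measure_induct_rule[of godel])
    case (less a)
    show ?case
    proof (cases "a \<in> T")
      case True
      then show ?thesis by (auto simp: le_def intro!: bexI[of _ a] exI[of _ 0])
    next
      case False
      then obtain a' where a': "a' \<in> S" "le a' a" "a' \<noteq> a" using less.prems by (auto simp: T_def)
      then obtain b where "b \<in> T" "le b a'" using less.IH le_godel by blast
      then show ?thesis using a'(2) le_trans by blast
    qed
  qed
  moreover have "finite T"
  proof (rule ccontr)
    assume "infinite T"
    then obtain f :: "nat \<Rightarrow> _" where f: "inj f" "range f \<subseteq> T"
      using infinite_countable_subset by blast
    obtain r where r: "strict_mono (r :: nat \<Rightarrow> nat)"
        "\<And>i. incseq ((\<lambda>k. Poly_Mapping.lookup (f k) i) \<circ> r)"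
      using nat_family_incseq_subseq[OF finite_class.finite_UNIV, of "\<lambda>i k. Poly_Mapping.lookup (f k) i"] by auto
    have "le (f (r 0)) (f (r 1))"
      using incseqD[OF r(2), of 0 1] by (intro leI) simp
    moreover have "f (r 0) \<in> T" "f (r 1) \<in> T" using f(2) by auto
    ultimately have "f (r 0) = f (r 1)" unfolding T_def by blast
    then have "r 0 = r 1" using f(1) by (simp add: inj_eq)
    then show False using r(1) by (simp add: strict_mono_eq)
  qed
  ultimately show ?thesis by (intro exI[of _ T]) (auto simp: T_def le_def)
qed

text \<open>Generation is expressed by minimality: every ideal containing \<open>H\<close> contains
  \<open>I\<close>. Dickson's lemma selects finitely many leading monomials, and division by the
  corresponding elements lowers the leading \<open>godel\<close> value, so it terminates.\<close>

theorem hilbert_basis: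
  fixes I :: "('n::finite) rpoly set"
  assumes I: "ring_ideal I"
  shows "\<exists>H\<subseteq>I. finite H \<and> (\<forall>S. ring_ideal S \<and> H \<subseteq> S \<longrightarrow> I \<subseteq> S)"
proof -
  define lead where "lead = (\<lambda>(f :: 'n rpoly) a. coef f a \<noteq> 0 \<and> (\<forall>b\<in>mons f. godel b \<le> godel a))"
  obtain T where T: "T \<subseteq> {a. \<exists>f\<in>I. lead f a}" "finite T"
      "\<forall>a\<in>{a. \<exists>f\<in>I. lead f a}. \<exists>b\<in>T. \<exists>c. a = b + c"
    using dickson[of "{a. \<exists>f\<in>I. lead f a}"] by (elim exE conjE that)
  obtain h where h: "\<And>b. b \<in> T \<Longrightarrow> h b \<in> I" "\<And>b. b \<in> T \<Longrightarrow> lead (h b) b"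
    using T(1) by (auto simp: subset_iff) metis
  have "f \<in> S" if S: "ring_ideal S" "h ` T \<subseteq> S" and "f \<in> I" "\<forall>a\<in>mons f. godel a < m" for f S m
    using that(3,4)
  proof (induction m arbitrary: f)
    case 0
    then have "f = 0" by simp
    then show ?case using ideal_zero[OF S(1)] by simp
  next
    case (Suc m)
    show ?case
    proof (cases "\<exists>a\<in>mons f. godel a = m")
      case False
      then show ?thesis using Suc by (metis less_SucE)
    next
      case True
      then obtain a where a: "a \<in> mons f" "godel a = m" by blast
      then have "lead f a" using Suc.prems by (auto simp: lead_def in_keys_iff less_Suc_eq_le)
      then have "a \<in> {a. \<exists>f\<in>I. lead f a}" using Suc.prems by blast
      then obtain b c where b: "b \<in> T" and "a = b + c" using T(3) by blast
      then have bc: "b \<in> T" "a = c + b" by (simp_all add: add.commute)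
      note hb = h(2)[OF bc(1), unfolded lead_def]
      \<comment> \<open>The monomial multiple of \<open>h b\<close> with the same leading term as
        \<open>f\<close>; subtracting it leaves only monomials of smaller \<open>godel\<close>
        value.\<close>
      define g where "g = Poly_Mapping.single c (coef f a / coef (h b) b) * h b"
      have "coef g (c + b) = coef f a / coef (h b) b * coef (h b) b"
        unfolding g_def using hb by (subst coef_mult_top) (auto split: if_splits)
      then have ga: "coef (f - g) a = 0" using hb bc by (simp add: lookup_minus)
      have "godel d \<le> m" if "d \<in> mons g" for d
      proof -
        obtain e where "d = c + e" "e \<in> mons (h b)"
          using \<open>d \<in> mons g\<close> keys_mult[of "Poly_Mapping.single c (coef f a / coef (h b) b)" "h b"]
          by (auto simp: g_def split: if_splits)
        moreover have "godel c * godel e \<le> godel c * godel b"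
          using hb \<open>e \<in> mons (h b)\<close> by simp
        ultimately show ?thesis by (simp flip: a(2) add: bc(2) godel_add)
      qed
      moreover have "godel d \<le> m" if "d \<in> mons f" for d
        using that Suc.prems(2) by (simp add: less_Suc_eq_le)
      moreover have "d \<in> mons f \<or> d \<in> mons g" if "d \<in> mons (f - g)" for d
        using that by (auto simp: in_keys_iff lookup_minus)
      ultimately have "godel d \<le> m" if "d \<in> mons (f - g)" for d
        using that by blast
      moreover have "godel d \<noteq> m" if "d \<in> mons (f - g)" for d
        using that ga a(2) injD[OF godel_inj, of d a] by (auto simp: in_keys_iff)
      ultimately have lt: "\<forall>d\<in>mons (f - g). godel d < m" by (simp add: le_neq_implies_less)
      have "g \<in> I" "g \<in> S"
        unfolding g_def using h(1)[OF bc(1)] S bc(1) by (auto intro!: ideal_mult[OF I] ideal_mult[OF S(1)])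
      then have "f - g \<in> S" using Suc.IH[OF _ lt] ideal_diff[OF I] Suc.prems(1) by blast
      then have "f - g + g \<in> S" using \<open>g \<in> S\<close> by (rule ideal_add[OF S(1)])
      then show ?thesis by simp
    qed
  qed
  moreover have "\<forall>a\<in>mons f. godel a < Suc (Max (insert 0 (godel ` mons f)))" for f :: "'n rpoly"
    by (auto simp: less_Suc_eq_le)
  ultimately have "I \<subseteq> S" if "ring_ideal S" "h ` T \<subseteq> S" for S using that by blast
  then show ?thesis using T(2) h(1) by (intro exI[of _ "h ` T"]) auto
qed

section \<open>Degrees\<close>

definition low_mons :: "nat \<Rightarrow> (('n::finite) \<Rightarrow>\<^sub>0 nat) set" where
  "low_mons d = {a. (\<Sum>i\<in>UNIV. Poly_Mapping.lookup a i) \<le> d}"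

lemma mdeg_le_iff: "mdeg p \<le> d \<longleftrightarrow> mons p \<subseteq> low_mons d"
  by (auto simp: mdeg_def low_mons_def)

lemma finite_low_mons: "finite (low_mons d :: (('n::finite) \<Rightarrow>\<^sub>0 nat) set)"
proof (rule finite_imageD)
  have "Poly_Mapping.lookup ` (low_mons d :: ('n \<Rightarrow>\<^sub>0 nat) set) \<subseteq> (UNIV \<rightarrow>\<^sub>E {..d})"
  proof (rule image_subsetI)
    fix a :: "'n \<Rightarrow>\<^sub>0 nat"
    assume "a \<in> low_mons d"
    moreover have "Poly_Mapping.lookup a i \<le> (\<Sum>i\<in>UNIV. Poly_Mapping.lookup a i)" for i
      by (intro member_le_sum) auto
    ultimately have "Poly_Mapping.lookup a i \<le> d" for i
      unfolding low_mons_def using order_trans by blast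
    then show "Poly_Mapping.lookup a \<in> UNIV \<rightarrow>\<^sub>E {..d}" by (simp add: PiE_iff)
  qed
  then show "finite (Poly_Mapping.lookup ` (low_mons d :: ('n \<Rightarrow>\<^sub>0 nat) set))"
    by (rule finite_subset) (intro finite_PiE; simp)
  show "inj_on Poly_Mapping.lookup (low_mons d :: ('n \<Rightarrow>\<^sub>0 nat) set)"
    by (auto intro!: inj_onI poly_mapping_eqI)
qed

lemma mdeg_cst: "mdeg (cst c) = 0"
  by (simp add: mdeg_def)

lemma mdeg_one: "mdeg 1 = 0"
  using mdeg_cst[of 1] by simp

lemma mdeg_zero: "mdeg 0 = 0"
  by (simp add: mdeg_def)

lemma mdeg_uminus: "mdeg (- p) = mdeg p"
proof -
  have "mons (- p) = mons p" by (auto simp: in_keys_iff)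
  then show ?thesis by (simp add: mdeg_def)
qed

lemma mdeg_add_le: "mdeg p \<le> d \<Longrightarrow> mdeg q \<le> d \<Longrightarrow> mdeg (p + q) \<le> d"
  using keys_add[of p q] unfolding mdeg_le_iff by blast

lemma mdeg_sum_le: "(\<And>i. i \<in> A \<Longrightarrow> mdeg (p i) \<le> d) \<Longrightarrow> mdeg (sum p A) \<le> d"
  by (induction A rule: infinite_finite_induct) (auto simp: mdeg_zero intro!: mdeg_add_le)

lemma mdeg_mult: "mdeg (p * q) \<le> mdeg p + mdeg q"
proof -
  have "mons (p * q) \<subseteq> mon_sums (low_mons (mdeg p)) (low_mons (mdeg q))"
    by (intro mons_mult_subset) (simp_all flip: mdeg_le_iff)
  also have "\<dots> \<subseteq> low_mons (mdeg p + mdeg q)"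
    by (auto simp: mon_sums_def low_mons_def lookup_add sum.distrib intro: add_mono)
  finally show ?thesis by (simp add: mdeg_le_iff)
qed

lemma mdeg_cst_mult: "mdeg (cst c * p) \<le> mdeg p"
  using mdeg_mult[of "cst c" p] by (simp add: mdeg_cst)

lemma mdeg_power: "mdeg (p ^ n) \<le> n * mdeg p"
proof (induction n)
  case (Suc n)
  then show ?case using mdeg_mult[of p "p ^ n"] by simp
qed (simp add: mdeg_one)

section \<open>Truncated quadratic modules\<close>

text \<open>A conjunctive form of the conditions in \<open>qmod_trunc\<close>. Natural subtraction
  gives \<open>t - mdeg g = 0\<close> if \<open>mdeg g > t\<close>, which would still admit
  constants; hence the separate clause forcing \<open>s g = 0\<close>.\<close>

definition trunc_weights ::
    "nat \<Rightarrow> ('n::finite) rpoly set \<Rightarrow> 'n rpoly \<Rightarrow> ('n rpoly \<Rightarrow> 'n rpoly) \<Rightarrow> bool" where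
  "trunc_weights t G s0 s \<longleftrightarrow> s0 \<in> sos \<and> mdeg s0 \<le> t
    \<and> (\<forall>g\<in>G. s g \<in> sos \<and> mdeg (s g) \<le> t - mdeg g \<and> (mdeg g \<le> t \<or> s g = 0))"

lemma qmod_trunc_iff:
  fixes x :: "('n::finite) rpoly"
  shows "x \<in> qmod_trunc t G \<longleftrightarrow> (\<exists>s0 s. x = s0 + (\<Sum>g\<in>G. s g * g) \<and> trunc_weights t G s0 s)"
proof -
  have "(s g \<in> sos \<and> (if mdeg g \<le> t then mdeg (s g) \<le> t - mdeg g else s g = 0))
      \<longleftrightarrow> (s g \<in> sos \<and> mdeg (s g) \<le> t - mdeg g \<and> (mdeg g \<le> t \<or> s g = 0))" for s :: "'n rpoly \<Rightarrow> 'n rpoly" and g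
    by (auto simp: mdeg_zero)
  then show ?thesis unfolding qmod_trunc_def trunc_weights_def by (simp only: mem_Collect_eq)
qed

lemma qmod_truncI:
  assumes "trunc_weights t G s0 s" "x = s0 + (\<Sum>g\<in>G. s g * g)"
  shows "x \<in> qmod_trunc t G"
  using assms unfolding qmod_trunc_iff by blast

lemma sos_in_qmod_trunc: "s \<in> sos \<Longrightarrow> mdeg s \<le> t \<Longrightarrow> s \<in> qmod_trunc t G"
  unfolding qmod_trunc_iff trunc_weights_def
  by (rule exI[of _ s], rule exI[of _ "\<lambda>_. 0"]) (auto simp: zero_sos mdeg_zero)

lemma qmod_trunc_mono:
  assumes "x \<in> qmod_trunc t G" "t \<le> t'"
  shows "x \<in> qmod_trunc t' G"
proof -
  obtain s0 s where "x = s0 + (\<Sum>g\<in>G. s g * g)" "trunc_weights t G s0 s"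
    using assms(1) unfolding qmod_trunc_iff by blast
  moreover from this(2) have "trunc_weights t' G s0 s"
    using assms(2) unfolding trunc_weights_def by fastforce
  ultimately show ?thesis unfolding qmod_trunc_iff by blast
qed

lemma qmod_trunc_add:
  assumes "x \<in> qmod_trunc t G" "y \<in> qmod_trunc t G"
  shows "x + y \<in> qmod_trunc t G"
proof -
  obtain s0 s where s: "x = s0 + (\<Sum>g\<in>G. s g * g)" "trunc_weights t G s0 s"
    using assms(1) unfolding qmod_trunc_iff by blast
  obtain r0 r where r: "y = r0 + (\<Sum>g\<in>G. r g * g)" "trunc_weights t G r0 r"
    using assms(2) unfolding qmod_trunc_iff by blast
  have "trunc_weights t G (s0 + r0) (\<lambda>g. s g + r g)"
    using s(2) r(2) unfolding trunc_weights_def by (auto simp: sos_add mdeg_add_le) (metis add_0)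
  moreover have "x + y = (s0 + r0) + (\<Sum>g\<in>G. (s g + r g) * g)"
    by (simp add: s(1) r(1) sum.distrib distrib_right add_ac)
  ultimately show ?thesis by (rule qmod_truncI)
qed

lemma qmod_trunc_cst_mult:
  assumes "x \<in> qmod_trunc t G" "c \<ge> 0"
  shows "cst c * x \<in> qmod_trunc t G"
proof -
  obtain s0 s where s: "x = s0 + (\<Sum>g\<in>G. s g * g)" "trunc_weights t G s0 s"
    using assms(1) unfolding qmod_trunc_iff by blast
  have "trunc_weights t G (cst c * s0) (\<lambda>g. cst c * s g)"
    using s(2) assms(2) unfolding trunc_weights_def
    by (auto simp: sos_cst_mult intro: order_trans[OF mdeg_cst_mult])
  moreover have "cst c * x = cst c * s0 + (\<Sum>g\<in>G. (cst c * s g) * g)"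
    by (simp add: s(1) distrib_left sum_distrib_left mult.assoc)
  ultimately show ?thesis by (rule qmod_truncI)
qed

lemma qmod_trunc_mdeg:
  assumes "x \<in> qmod_trunc t G"
  shows "mdeg x \<le> t"
proof -
  obtain s0 s where s: "x = s0 + (\<Sum>g\<in>G. s g * g)" "trunc_weights t G s0 s"
    using assms(1) unfolding qmod_trunc_iff by blast
  have "mdeg (s g * g) \<le> t" if "g \<in> G" for g
    using mdeg_mult[of "s g" g] s(2) that by (auto simp: trunc_weights_def mdeg_zero)
  then show ?thesis using s by (auto simp: trunc_weights_def intro!: mdeg_add_le mdeg_sum_le)
qed

lemma qmod_iff:
  assumes "finite G"
  shows "x \<in> qmod G \<longleftrightarrow> (\<exists>s0 s. x = s0 + (\<Sum>g\<in>G. s g * g) \<and> s0 \<in> sos \<and> (\<forall>g\<in>G. s g \<in> sos))"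
proof
  assume "x \<in> qmod G"
  then show "\<exists>s0 s. x = s0 + (\<Sum>g\<in>G. s g * g) \<and> s0 \<in> sos \<and> (\<forall>g\<in>G. s g \<in> sos)"
    unfolding qmod_def UN_iff qmod_trunc_iff trunc_weights_def by blast
next
  assume "\<exists>s0 s. x = s0 + (\<Sum>g\<in>G. s g * g) \<and> s0 \<in> sos \<and> (\<forall>g\<in>G. s g \<in> sos)"
  then obtain s0 s where s: "x = s0 + (\<Sum>g\<in>G. s g * g)" "s0 \<in> sos" "\<forall>g\<in>G. s g \<in> sos" by blast
  define t where "t = mdeg s0 + (\<Sum>g\<in>G. mdeg (s g) + mdeg g)"
  have t: "mdeg (s g) + mdeg g \<le> t" if "g \<in> G" for g
    using member_le_sum[OF that, of "\<lambda>g. mdeg (s g) + mdeg g"] assms by (simp add: t_def)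
  have "mdeg (s g) \<le> t - mdeg g" "mdeg g \<le> t" if "g \<in> G" for g
    using t[OF that] by auto
  then have "trunc_weights t G s0 s"
    using s by (auto simp: trunc_weights_def t_def)
  then have "x \<in> qmod_trunc t G"
    using s(1) by (rule qmod_truncI)
  then show "x \<in> qmod G" by (auto simp: qmod_def)
qed

lemma qmod_quad_module:
  assumes "finite G"
  shows "quad_module (qmod G)"
  unfolding quad_module_def
proof (intro conjI ballI allI)
  have "1 \<in> qmod_trunc 0 G"
    using square_sos[of 1] by (intro sos_in_qmod_trunc) (auto simp: mdeg_one)
  then show "1 \<in> qmod G" by (auto simp: qmod_def)
  fix x assume "x \<in> qmod G"
  then obtain s0 s where s: "x = s0 + (\<Sum>g\<in>G. s g * g)" "s0 \<in> sos" "\<forall>g\<in>G. s g \<in> sos"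
    using qmod_iff[OF assms] by blast
  show "h^2 * x \<in> qmod G" for h
    unfolding qmod_iff[OF assms]
    by (rule exI[of _ "h^2 * s0"], rule exI[of _ "\<lambda>g. h^2 * s g"])
      (use s in \<open>auto simp: sos_square_mult distrib_left sum_distrib_left mult.assoc\<close>)
  fix y assume "y \<in> qmod G"
  then obtain r0 r where r: "y = r0 + (\<Sum>g\<in>G. r g * g)" "r0 \<in> sos" "\<forall>g\<in>G. r g \<in> sos"
    using qmod_iff[OF assms] by blast
  show "x + y \<in> qmod G"
    unfolding qmod_iff[OF assms]
    by (rule exI[of _ "s0 + r0"], rule exI[of _ "\<lambda>g. s g + r g"])
      (use s r in \<open>auto simp: sos_add sum.distrib algebra_simps\<close>)
qed

lemma qmod_least:
  assumes "finite G" "quad_module M" "G \<subseteq> M"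
  shows "qmod G \<subseteq> M"
proof
  fix x assume "x \<in> qmod G"
  then obtain s0 s where x: "x = s0 + (\<Sum>g\<in>G. s g * g)" "s0 \<in> sos" "\<forall>g\<in>G. s g \<in> sos"
    using qmod_iff[OF assms(1)] by blast
  have "(\<Sum>g\<in>G. s g * g) \<in> M"
    using x(3) assms(3) by (intro qm_sum[OF assms(2)] qm_sos_mult[OF assms(2)]) auto
  then show "x \<in> M"
    unfolding x(1) by (rule qm_add[OF assms(2) qm_sos[OF assms(2) x(2)]])
qed

lemma generator_in_qmod:
  assumes "finite G" "g \<in> G"
  shows "g \<in> qmod G"
  unfolding qmod_iff[OF assms(1)]
proof (intro exI conjI ballI)
  have "(\<Sum>h\<in>G. (if h = g then 1 else 0) * h) = (\<Sum>h\<in>G. if h = g then h else 0)"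
    by (intro sum.cong) auto
  then show "g = 0 + (\<Sum>h\<in>G. (if h = g then 1 else 0) * h)"
    using assms by simp
qed (use square_sos[of 1] zero_sos in auto)

section \<open>The real radical of the support\<close>

lemma real_radical_ideal:
  assumes "quad_module M"
  shows "ring_ideal (real_radical (supp M))"
proof -
  have "real_radical (supp M) = {f. \<exists>n. f ^ n \<in> supp M}"
    using real_radical_supp_iff[OF assms] by blast
  then show ?thesis using radical_ideal[OF supp_ideal[OF assms]] by simp
qed

lemma real_radical_power:
  assumes "quad_module M" "f ^ n \<in> real_radical (supp M)"
  shows "f \<in> real_radical (supp M)"
  using assms(2) unfolding real_radical_supp_iff[OF assms(1)]
  by (metis power_mult)

text \<open>Convexity of the real radical with respect to \<open>M\<close>. It yields both the
  support of \<open>Q + J\<close> and the definiteness needed for closedness.\<close>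

lemma real_radical_summand:
  assumes "quad_module M" "a \<in> M" "b \<in> M" "a + b \<in> real_radical (supp M)"
  shows "a \<in> real_radical (supp M)"
  using assms summand_nilpotent_supp real_radical_supp_iff by metis

lemma quad_module_plus_ideal:
  assumes "quad_module M" "ring_ideal I"
  shows "quad_module {q + j | q j. q \<in> M \<and> j \<in> I}"
  unfolding quad_module_def
proof (intro conjI ballI allI)
  show "1 \<in> {q + j | q j. q \<in> M \<and> j \<in> I}"
    using qm_one[OF assms(1)] ideal_zero[OF assms(2)] by force
  fix x assume "x \<in> {q + j | q j. q \<in> M \<and> j \<in> I}"
  then obtain q j where x: "x = q + j" "q \<in> M" "j \<in> I" by blast
  show "h^2 * x \<in> {q + j | q j. q \<in> M \<and> j \<in> I}" for h
    using x qm_square_mult[OF assms(1)] ideal_mult[OF assms(2)] by (force simp: distrib_left)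
  fix y assume "y \<in> {q + j | q j. q \<in> M \<and> j \<in> I}"
  then obtain q' j' where y: "y = q' + j'" "q' \<in> M" "j' \<in> I" by blast
  have "x + y = (q + q') + (j + j')" by (simp add: x y)
  then show "x + y \<in> {q + j | q j. q \<in> M \<and> j \<in> I}"
    using x y qm_add[OF assms(1)] ideal_add[OF assms(2)] by blast
qed

lemma supp_quad_module_plus_real_radical:
  assumes M: "quad_module M"
  shows "supp {q + j | q j. q \<in> M \<and> j \<in> real_radical (supp M)} = real_radical (supp M)"
proof -
  note J = real_radical_ideal[OF M]
  show ?thesis
  proof (intro equalityI subsetI)
    fix f assume "f \<in> supp {q + j | q j. q \<in> M \<and> j \<in> real_radical (supp M)}"
    then obtain q j q' j' where f: "f = q + j" "- f = q' + j'" "q \<in> M" "q' \<in> M"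
        "j \<in> real_radical (supp M)" "j' \<in> real_radical (supp M)"
      unfolding supp_iff by blast
    have "q + q' + (j + j') = (q + j) + (q' + j')" by (simp only: add_ac)
    also have "\<dots> = 0" by (simp flip: f(1,2))
    finally have "q + q' = - (j + j')" by (simp only: eq_neg_iff_add_eq_0)
    then have "q + q' \<in> real_radical (supp M)"
      using f J ideal_add ideal_uminus by metis
    then have "q \<in> real_radical (supp M)"
      using real_radical_summand[OF M] f by blast
    then show "f \<in> real_radical (supp M)" using f J ideal_add by metis
  next
    fix f assume f: "f \<in> real_radical (supp M)"
    have "g \<in> {q + j | q j. q \<in> M \<and> j \<in> real_radical (supp M)}"
      if "g \<in> real_radical (supp M)" for g
      using that qm_zero[OF M] by (intro CollectI exI[of _ 0] exI[of _ g]) simp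
    then show "f \<in> supp {q + j | q j. q \<in> M \<and> j \<in> real_radical (supp M)}"
      using f ideal_uminus[OF J f] by (simp only: supp_iff)
  qed
qed

section \<open>The closures of the truncations\<close>

text \<open>One finite \<open>M\<close> serves every sum of squares supported on \<open>K\<close>,
  both as index set of the squares and as bound on their supports.\<close>

lemma sos_bounded_representation:
  fixes K :: "(('n::finite) \<Rightarrow>\<^sub>0 nat) set"
  assumes "finite K"
  shows "\<exists>M. finite M \<and> (\<forall>s\<in>sos. mons s \<subseteq> K \<longrightarrow>
    (\<exists>q. s = (\<Sum>a\<in>M. (q a)^2) \<and> (\<forall>a\<in>M. mons (q a) \<subseteq> M)))"
proof -
  obtain M :: "('n \<Rightarrow>\<^sub>0 nat) set" where M: "finite M"
    "\<And>(I :: nat set) p. finite I \<Longrightarrow> mons (\<Sum>i\<in>I. (p i)^2) \<subseteq> K \<Longrightarrow> (\<forall>i\<in>I. mons (p i) \<subseteq> M)"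
    using sos_summands_support[OF assms, where 'i = nat] by metis
  have "\<exists>q. s = (\<Sum>a\<in>M. (q a)^2) \<and> (\<forall>a\<in>M. mons (q a) \<subseteq> M)"
    if "s \<in> sos" "mons s \<subseteq> K" for s :: "'n rpoly"
  proof -
    obtain I :: "nat set" and p where "finite I" "s = (\<Sum>i\<in>I. (p i)^2)"
      using \<open>s \<in> sos\<close> by (auto simp: sos_def)
    then show ?thesis
      using sum_squares_few[OF M(1), of I p] M(2)[of I p] that(2) by auto
  qed
  then show ?thesis using M(1) by blast
qed

lemma closure_qmod_trunc_subset:
  fixes G :: "('n::finite) rpoly set"
  assumes G: "finite G" and f: "f \<in> closure_deg d (qmod_trunc d G)"
  shows "\<exists>q\<in>qmod G. f - q \<in> real_radical (supp (qmod G))"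
proof -
  note Q = qmod_quad_module[OF G]
  note J = real_radical_ideal[OF Q]
  obtain x where x: "\<And>k. x k \<in> qmod_trunc d G" "\<And>k. mdeg (x k) \<le> d" "coef_lim x f"
    using f unfolding closure_deg_def coef_lim_def polys_deg_def by blast
  obtain M :: "('n \<Rightarrow>\<^sub>0 nat) set" where M: "finite M"
    "\<And>s. s \<in> sos \<Longrightarrow> mons s \<subseteq> low_mons d \<Longrightarrow>
      \<exists>q. s = (\<Sum>a\<in>M. (q a)^2) \<and> (\<forall>a\<in>M. mons (q a) \<subseteq> M)"
    using sos_bounded_representation[OF finite_low_mons[of d]] by blast
  \<comment> \<open>\<open>None\<close> stands for the generator 1, so that \<open>s0\<close> is
    treated like the other weights. The option type keeps the two apart even if 1 belongs to
    \<open>G\<close>.\<close>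
  define E where "E = insert None (Some ` G)"
  define \<gamma> where "\<gamma> = (\<lambda>e. case e of None \<Rightarrow> 1 | Some g \<Rightarrow> (g :: 'n rpoly))"
  have finE: "finite E" using G by (simp add: E_def)
  have \<gamma>Q: "\<gamma> e \<in> qmod G" if "e \<in> E" for e
    using that qm_one[OF Q] generator_in_qmod[OF G] by (auto simp: E_def \<gamma>_def)
  have "\<exists>p. x k = (\<Sum>e\<in>E. \<Sum>a\<in>M. (p e a)^2 * \<gamma> e) \<and> (\<forall>e\<in>E. \<forall>a\<in>M. mons (p e a) \<subseteq> M)" for k
  proof -
    obtain s0 s where s: "x k = s0 + (\<Sum>g\<in>G. s g * g)" "trunc_weights d G s0 s"
      using x(1)[of k] unfolding qmod_trunc_iff by blast
    define \<sigma> where "\<sigma> = (\<lambda>e. case e of None \<Rightarrow> s0 | Some g \<Rightarrow> s g)"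
    \<comment> \<open>The coarse bound \<open>d\<close> instead of \<open>d - mdeg g\<close> lets
      the same \<open>M\<close> represent all weights.\<close>
    have sg: "mdeg (s g) \<le> d" if "g \<in> G" for g
      using s(2) that by (auto simp: trunc_weights_def)
    have "\<sigma> e \<in> sos \<and> mons (\<sigma> e) \<subseteq> low_mons d" if "e \<in> E" for e
      using that s(2) sg by (auto simp: E_def \<sigma>_def trunc_weights_def simp flip: mdeg_le_iff)
    then have "\<forall>e\<in>E. \<exists>q. \<sigma> e = (\<Sum>a\<in>M. (q a)^2) \<and> (\<forall>a\<in>M. mons (q a) \<subseteq> M)"
      using M(2) by blast
    then obtain p where p: "\<forall>e\<in>E. \<sigma> e = (\<Sum>a\<in>M. (p e a)^2) \<and> (\<forall>a\<in>M. mons (p e a) \<subseteq> M)"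
      by metis
    have "x k = (\<Sum>e\<in>E. \<sigma> e * \<gamma> e)"
      using G by (simp add: E_def \<sigma>_def \<gamma>_def s(1) sum.reindex)
    also have "\<dots> = (\<Sum>e\<in>E. \<Sum>a\<in>M. (p e a)^2 * \<gamma> e)"
      using p by (intro sum.cong) (auto simp: sum_distrib_right)
    finally show ?thesis using p by blast
  qed
  then have "\<exists>p. \<forall>k. x k = (\<Sum>e\<in>E. \<Sum>a\<in>M. (p k e a)^2 * \<gamma> e) \<and> (\<forall>e\<in>E. \<forall>a\<in>M. mons (p k e a) \<subseteq> M)"
    by (intro choice allI)
  then obtain p where p: "\<And>k. x k = (\<Sum>e\<in>E. \<Sum>a\<in>M. (p k e a)^2 * \<gamma> e)"
      "\<And>k e a. e \<in> E \<Longrightarrow> a \<in> M \<Longrightarrow> mons (p k e a) \<subseteq> M" by blast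
  define A where "A = E \<times> M"
  have termQ: "(w i)^2 * \<gamma> (fst i) \<in> qmod G" if "i \<in> A" for w i
    using that \<gamma>Q by (auto simp: A_def intro!: qm_square_mult[OF Q])
  have "\<exists>w. f - (\<Sum>i\<in>A. (w i)^2 * \<gamma> (fst i)) \<in> real_radical (supp (qmod G))"
  proof (rule definite_cone_closed[OF J _ M(1) _ _ _ finite_low_mons _ x(3)])
    show "finite A" using finE M(1) by (simp add: A_def)
    show "mons (p k (fst i) (snd i)) \<subseteq> M" if "i \<in> A" for k i
      using that by (intro p(2)) (auto simp: A_def)
    show "x k = (\<Sum>i\<in>A. (p k (fst i) (snd i))^2 * \<gamma> (fst i))" for k
      by (simp add: p(1) A_def sum.cartesian_product case_prod_beta)
    show "mons (x k) \<subseteq> low_mons d" for k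
      using x(2) by (simp flip: mdeg_le_iff)
    fix w assume w: "(\<Sum>i\<in>A. (w i)^2 * \<gamma> (fst i)) \<in> real_radical (supp (qmod G))"
    show "\<forall>i\<in>A. w i * \<gamma> (fst i) \<in> real_radical (supp (qmod G))"
    proof
      fix i assume i: "i \<in> A"
      have "(w i)^2 * \<gamma> (fst i) + (\<Sum>i\<in>A - {i}. (w i)^2 * \<gamma> (fst i)) \<in> real_radical (supp (qmod G))"
        using w unfolding sum.remove[OF \<open>finite A\<close> i] .
      moreover have "(\<Sum>i\<in>A - {i}. (w i)^2 * \<gamma> (fst i)) \<in> qmod G"
        using termQ by (intro qm_sum[OF Q]) auto
      ultimately have "(w i)^2 * \<gamma> (fst i) \<in> real_radical (supp (qmod G))"
        using real_radical_summand[OF Q termQ[OF i]] by blast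
      \<comment> \<open>One more factor \<open>\<gamma> (fst i)\<close> completes the square of
        \<open>w i * \<gamma> (fst i)\<close>, and radicality removes the exponent.\<close>
      then have "(w i)^2 * \<gamma> (fst i) * \<gamma> (fst i) \<in> real_radical (supp (qmod G))"
        by (rule ideal_mult_right[OF J])
      then have "(w i * \<gamma> (fst i))^2 \<in> real_radical (supp (qmod G))"
        by (simp add: power2_eq_square algebra_simps)
      then show "w i * \<gamma> (fst i) \<in> real_radical (supp (qmod G))"
        by (rule real_radical_power[OF Q])
    qed
  qed
  moreover have "(\<Sum>i\<in>A. (w i)^2 * \<gamma> (fst i)) \<in> qmod G" for w
    using termQ by (intro qm_sum[OF Q])
  ultimately show ?thesis by blast
qed

text \<open>The coefficient \<open>1 / (2 * sqrt \<epsilon>)\<close> makes the cross term equal to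
  \<open>p\<close>. The price is \<open>p^2 / (4 * \<epsilon>)\<close>, the term that later has to
  be absorbed.\<close>

lemma complete_square:
  assumes "\<epsilon> > 0"
  shows "p + cst \<epsilon> + cst ((1 / (2 * sqrt \<epsilon>))^2) * p^2 = (cst (1 / (2 * sqrt \<epsilon>)) * p + cst (sqrt \<epsilon>))^2"
proof -
  have "2 * (cst (1 / (2 * sqrt \<epsilon>)) * cst (sqrt \<epsilon>)) = cst 2 * (cst (1 / (2 * sqrt \<epsilon>)) * cst (sqrt \<epsilon>))"
    by simp
  also have "\<dots> = 1"
    using assms unfolding cst_mult by simp
  finally have one: "2 * (cst (1 / (2 * sqrt \<epsilon>)) * cst (sqrt \<epsilon>)) = 1" .
  have "2 * cst (1 / (2 * sqrt \<epsilon>)) * p * cst (sqrt \<epsilon>) = 2 * (cst (1 / (2 * sqrt \<epsilon>)) * cst (sqrt \<epsilon>)) * p"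
    by (simp only: ac_simps)
  then have "2 * cst (1 / (2 * sqrt \<epsilon>)) * p * cst (sqrt \<epsilon>) = p"
    unfolding one by simp
  moreover have "cst (sqrt \<epsilon>)^2 = cst \<epsilon>"
    using assms by (simp add: cst_power)
  ultimately show ?thesis
    using assms by (simp add: power2_sum power_mult_distrib mult.assoc cst_power)
qed

text \<open>The induction step absorbs the term \<open>- c * f^(2^Suc k)\<close> by completing the square in
  \<open>- f^(2^Suc k)\<close>.\<close>

lemma perturbation_sos:
  fixes f :: "('n::finite) rpoly"
  assumes "\<epsilon> > 0"
  shows "\<exists>s\<in>sos. \<exists>c\<ge>0. mdeg s \<le> 2 ^ Suc k * mdeg f \<and> f + cst \<epsilon> + cst c * f ^ (2 ^ Suc k) = s"
  using assms
proof (induction k arbitrary: \<epsilon>)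
  case 0
  have "mdeg (cst (1 / (2 * sqrt \<epsilon>)) * f + cst (sqrt \<epsilon>)) \<le> mdeg f"
    by (intro mdeg_add_le mdeg_cst_mult) (simp add: mdeg_cst)
  then have "mdeg ((cst (1 / (2 * sqrt \<epsilon>)) * f + cst (sqrt \<epsilon>))^2) \<le> 2 * mdeg f"
    by (intro order_trans[OF mdeg_power]) simp
  then show ?case
    using complete_square[OF 0, of f]
    by (intro bexI[OF _ square_sos] exI[of _ "(1 / (2 * sqrt \<epsilon>))^2"]) simp
next
  case (Suc k)
  define F where "F = f ^ (2 ^ Suc k)"
  obtain s c where s: "s \<in> sos" "c \<ge> 0" "mdeg s \<le> 2 ^ Suc k * mdeg f" "f + cst (\<epsilon> / 2) + cst c * F = s"
    using Suc.IH[of "\<epsilon> / 2"] Suc.prems by (auto simp: F_def)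
  \<comment> \<open>Half of \<epsilon> was spent on the induction hypothesis. Scaling the completed
    square by \<open>c\<close> costs \<open>c * \<delta>\<close>, which this choice keeps within the
    other half; \<open>c + 1\<close> avoids dividing by zero. The remainder
    \<open>\<epsilon> / 2 - c * \<delta>\<close> is a nonnegative constant added to
    \<open>s'\<close>.\<close>
  define \<delta> where "\<delta> = \<epsilon> / (2 * (c + 1))"
  have \<delta>: "\<delta> > 0" "c * \<delta> \<le> \<epsilon> / 2"
    using s(2) Suc.prems by (auto simp: \<delta>_def field_simps)
  define c' where "c' = (1 / (2 * sqrt \<delta>))^2"
  define h where "h = cst (1 / (2 * sqrt \<delta>)) * (- F) + cst (sqrt \<delta>)"
  have h: "- F + cst \<delta> + cst c' * F^2 = h^2"
    using complete_square[OF \<delta>(1), of "- F"] by (simp add: c'_def h_def)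
  have "mdeg F \<le> 2 ^ Suc k * mdeg f" unfolding F_def by (rule mdeg_power)
  then have "mdeg h \<le> 2 ^ Suc k * mdeg f"
    unfolding h_def by (intro mdeg_add_le order_trans[OF mdeg_cst_mult]) (simp_all add: mdeg_cst mdeg_uminus)
  then have mh: "mdeg (h^2) \<le> 2 ^ Suc (Suc k) * mdeg f"
    by (intro order_trans[OF mdeg_power]) (simp add: mult.commute mult.left_commute)
  define s' where "s' = s + cst c * h^2 + cst (\<epsilon> / 2 - c * \<delta>) * 1^2"
  have "s' \<in> sos"
    unfolding s'_def using s \<delta> by (intro sos_add sos_cst_mult square_sos) auto
  moreover have "mdeg s' \<le> 2 ^ Suc (Suc k) * mdeg f"
    unfolding s'_def
    using mh s(3) by (intro mdeg_add_le order_trans[OF mdeg_cst_mult]) (auto simp: mdeg_one)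
  moreover have "f + cst \<epsilon> + cst (c * c') * f ^ (2 ^ Suc (Suc k)) = s'"
  proof -
    have "f ^ (2 ^ Suc (Suc k)) = F^2" by (simp add: F_def mult.commute flip: power_mult)
    moreover have "s' = f + (cst (\<epsilon> / 2) + cst c * cst \<delta> + cst (\<epsilon> / 2 - c * \<delta>)) + cst c * cst c' * F^2"
      unfolding s'_def s(4)[symmetric] h[symmetric] by (simp add: algebra_simps)
    moreover have "cst (\<epsilon> / 2) + cst c * cst \<delta> + cst (\<epsilon> / 2 - c * \<delta>) = (cst \<epsilon> :: 'n rpoly)"
      by (simp add: cst_mult flip: single_add)
    ultimately show ?thesis by (simp only: cst_mult)
  qed
  moreover have "c * c' \<ge> 0" using s(2) by (simp add: c'_def)
  ultimately show ?case by blast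
qed

text \<open>\<open>D\<close> precedes \<epsilon>: a fixed truncation contains \<open>- F\<close>,
  and scaling by the constant \<open>c\<close> stays inside it. Only the coefficient
  \<open>c\<close> depends on \<epsilon>.\<close>

lemma real_radical_perturbation:
  assumes G: "finite G" and j: "j \<in> real_radical (supp (qmod G))"
  shows "\<exists>D. \<forall>\<epsilon>>0. j + cst \<epsilon> \<in> qmod_trunc D G"
proof -
  note Q = qmod_quad_module[OF G]
  obtain n where n: "j ^ n \<in> supp (qmod G)"
    using j real_radical_supp_iff[OF Q] by blast
  define F where "F = j ^ (2 ^ Suc n)"
  have "n \<le> 2 ^ Suc n" using less_exp[of "Suc n"] by linarith
  then have "F = j ^ (2 ^ Suc n - n) * j ^ n" unfolding F_def by (simp only: power_add[symmetric] le_add_diff_inverse2)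
  then have "F \<in> supp (qmod G)" using ideal_mult[OF supp_ideal[OF Q] n] by simp
  then obtain e where e: "- F \<in> qmod_trunc e G" by (auto simp: supp_iff qmod_def)
  define D where "D = max e (2 ^ Suc n * mdeg j)"
  have "j + cst \<epsilon> \<in> qmod_trunc D G" if "\<epsilon> > 0" for \<epsilon>
  proof -
    obtain s c where s: "s \<in> sos" "c \<ge> 0" "mdeg s \<le> 2 ^ Suc n * mdeg j" "j + cst \<epsilon> + cst c * F = s"
      using perturbation_sos[OF \<open>\<epsilon> > 0\<close>, of n j] unfolding F_def by blast
    have "s \<in> qmod_trunc D G" using s by (intro sos_in_qmod_trunc) (auto simp: D_def)
    moreover have "cst c * (- F) \<in> qmod_trunc D G"
      using qmod_trunc_mono[OF e, of D] s(2) by (intro qmod_trunc_cst_mult) (auto simp: D_def)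
    ultimately have "s + cst c * (- F) \<in> qmod_trunc D G" by (rule qmod_trunc_add)
    moreover have "j + cst \<epsilon> = s + cst c * (- F)" by (simp flip: s(4))
    ultimately show ?thesis by simp
  qed
  then show ?thesis by blast
qed

lemma qmod_tilde_eq:
  fixes G :: "('n::finite) rpoly set"
  assumes G: "finite G"
  shows "qmod_tilde G = {q + j | q j. q \<in> qmod G \<and> j \<in> real_radical (supp (qmod G))}"
proof (intro equalityI subsetI)
  fix f assume "f \<in> qmod_tilde G"
  then obtain q where "q \<in> qmod G" "f - q \<in> real_radical (supp (qmod G))"
    using closure_qmod_trunc_subset[OF G] by (auto simp: qmod_tilde_def)
  then show "f \<in> {q + j | q j. q \<in> qmod G \<and> j \<in> real_radical (supp (qmod G))}"
    by (intro CollectI exI[of _ q] exI[of _ "f - q"]) simp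
next
  fix f assume "f \<in> {q + j | q j. q \<in> qmod G \<and> j \<in> real_radical (supp (qmod G))}"
  then obtain q j where f: "f = q + j" "q \<in> qmod G" "j \<in> real_radical (supp (qmod G))" by blast
  obtain e where e: "q \<in> qmod_trunc e G" using f(2) by (auto simp: qmod_def)
  obtain e' where e': "\<And>\<epsilon>. \<epsilon> > 0 \<Longrightarrow> j + cst \<epsilon> \<in> qmod_trunc e' G"
    using real_radical_perturbation[OF G f(3)] by blast
  define D where "D = max e e'"
  \<comment> \<open>With \<open>j + cst (1 / real (Suc k))\<close> in a fixed truncation for every
    \<open>k\<close>, adding \<open>q\<close> keeps the sequence in degree \<open>D\<close>.\<close>
  define x where "x = (\<lambda>k. f + cst (1 / real (Suc k)))"
  have x: "x k \<in> qmod_trunc D G" for k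
  proof -
    have "q + (j + cst (1 / real (Suc k))) \<in> qmod_trunc D G"
      using qmod_trunc_mono[OF e, of D] qmod_trunc_mono[OF e', of _ D]
      by (rule qmod_trunc_add) (auto simp: D_def)
    then show ?thesis by (simp add: x_def f(1) add.assoc)
  qed
  have lim: "coef_lim x f"
    unfolding coef_lim_def
  proof
    fix a
    have "(\<lambda>k. coef f a + (if a = 0 then inverse (real (Suc k)) else 0)) \<longlonglongrightarrow> coef f a + 0"
      using LIMSEQ_inverse_real_of_nat by (intro tendsto_add tendsto_const) (cases "a = 0"; simp)
    moreover have "coef (x k) a = coef f a + (if a = 0 then inverse (real (Suc k)) else 0)" for k
      by (auto simp: x_def lookup_add lookup_single divide_inverse)
    ultimately show "(\<lambda>k. coef (x k) a) \<longlonglongrightarrow> coef f a" by simp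
  qed
  have deg: "mdeg (x k) \<le> D" for k using qmod_trunc_mdeg[OF x] .
  then have "mdeg f \<le> D"
    using coef_lim_mons[OF lim, of "low_mons D"] by (simp add: mdeg_le_iff)
  then have "f \<in> closure_deg D (qmod_trunc D G)"
    unfolding closure_deg_def polys_deg_def
    using x deg lim by (auto simp: coef_lim_def intro!: exI[of _ x])
  then show "f \<in> qmod_tilde G" by (auto simp: qmod_tilde_def)
qed

text \<open>Ideal generators \<open>H\<close> of \<open>J\<close> are adjoined with both signs,
  which places them in the support of the new quadratic module. As that support is an ideal, it
  contains all of \<open>J\<close>.\<close>

lemma qmod_plus_ideal_finitely_generated:
  fixes G :: "('n::finite) rpoly set"
  assumes G: "finite G" and J: "ring_ideal J"
  shows "\<exists>G'. finite G' \<and> {q + j | q j. q \<in> qmod G \<and> j \<in> J} = qmod G'"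
proof -
  obtain H where H: "H \<subseteq> J" "finite H" "\<And>S. ring_ideal S \<Longrightarrow> H \<subseteq> S \<Longrightarrow> J \<subseteq> S"
    using hilbert_basis[OF J] by blast
  define G' where "G' = G \<union> H \<union> uminus ` H"
  have G': "finite G'" using G H(2) by (simp add: G'_def)
  note Q' = qmod_quad_module[OF G']
  have "{q + j | q j. q \<in> qmod G \<and> j \<in> J} \<subseteq> qmod G'"
  proof -
    have "qmod G \<subseteq> qmod G'"
      using generator_in_qmod[OF G'] by (intro qmod_least[OF G Q']) (auto simp: G'_def)
    moreover have "H \<subseteq> supp (qmod G')"
      using generator_in_qmod[OF G'] by (auto simp: supp_iff G'_def)
    then have "J \<subseteq> supp (qmod G')" by (rule H(3)[OF supp_ideal[OF Q']])
    ultimately show ?thesis by (auto simp: supp_def intro!: qm_add[OF Q'])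
  qed
  moreover have "qmod G' \<subseteq> {q + j | q j. q \<in> qmod G \<and> j \<in> J}"
  proof (rule qmod_least[OF G' quad_module_plus_ideal[OF qmod_quad_module[OF G] J]])
    have "g \<in> {q + j | q j. q \<in> qmod G \<and> j \<in> J}" if "g \<in> qmod G" for g
      using that ideal_zero[OF J] by (intro CollectI exI[of _ g] exI[of _ 0]) simp
    moreover have "h \<in> {q + j | q j. q \<in> qmod G \<and> j \<in> J}" if "h \<in> J" for h
      using that qm_zero[OF qmod_quad_module[OF G]] by (intro CollectI exI[of _ 0] exI[of _ h]) simp
    moreover have "uminus ` H \<subseteq> J" using H(1) ideal_uminus[OF J] by auto
    ultimately show "G' \<subseteq> {q + j | q j. q \<in> qmod G \<and> j \<in> J}"
      unfolding G'_def using generator_in_qmod[OF G] H(1) by (intro Un_least subsetI) blast+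
  qed
  ultimately show ?thesis using G' by blast
qed

theorem mainTheorem1:
  fixes G :: "('n::finite) rpoly set"
  assumes "finite G"
  defines "J \<equiv> real_radical (supp (qmod G))"
  shows "qmod_tilde G = {q + j | q j. q \<in> qmod G \<and> j \<in> J}
    \<and> supp (qmod_tilde G) = J
    \<and> (\<exists>G'. finite G' \<and> qmod_tilde G = qmod G')
    \<and> (\<forall>G'::'n rpoly set. finite G' \<and> qmod G' = qmod G \<longrightarrow> qmod_tilde G' = qmod_tilde G)"
proof (intro conjI allI impI)
  note Q = qmod_quad_module[OF assms(1)]
  show eq: "qmod_tilde G = {q + j | q j. q \<in> qmod G \<and> j \<in> J}"
    unfolding J_def by (rule qmod_tilde_eq[OF assms(1)])
  show "supp (qmod_tilde G) = J"
    unfolding eq unfolding J_def by (rule supp_quad_module_plus_real_radical[OF Q])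
  show "\<exists>G'. finite G' \<and> qmod_tilde G = qmod G'"
    unfolding eq
    by (rule qmod_plus_ideal_finitely_generated[OF assms(1) real_radical_ideal[OF Q, folded J_def]])
  \<comment> \<open>The formula for \<open>qmod_tilde\<close> involves the generators only through
    the quadratic module they generate.\<close>
  fix G' :: "'n rpoly set"
  assume "finite G' \<and> qmod G' = qmod G"
  then show "qmod_tilde G' = qmod_tilde G"
    using qmod_tilde_eq[of G'] qmod_tilde_eq[OF assms(1)] by simp
qed

end
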